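(* In the setting described in the context, let $b_h\in C_h$ and $\hat b_h\in\Lambda_h$ be (the magnetic field components of) the solution $(L_h,u_h,p_h,J_h,b_h,r_h,\hat u_h,\hat p_h,\hat b_h,\hat r_h)\in G_h\times V_h\times Q_h\times H_h\times C_h\times S_h\times M_h\times P_h\times\Lambda_h\times\Gamma_h$ to the E-HDG discretization consisting of (L1)-(L6), (C1)-(C4), (B1)-(B2), (D1)-(D3) and (Z). Then (i) $\nabla\cdot(b_h|_K)=0$ for all $K\in\Omega_h$; (ii) $[\![b_h\cdot n]\!]|_e=0$ for all $e\in\mathcal{E}_h^o$; (iii) $b_h\cdot n=\hat b_h\cdot n$ on $e$, for all $e\in\mathcal{E}_h^\partial$.
   Context: **Domain and mesh.** $\Omega\subset\mathbb{R}^d$, $d\in\{2,3\}$, is a bounded, simply connected domain whose boundary is a Lipschitz manifold with only one component, with a shape-regular triangulation $\Omega_h$ into finitely many nonoverlapping $d$-simplices $K$. $\mathcal{E}_h$ is the set of all facets ($(d-1)$-simplices) of the triangulation, $\mathcal{E}_h^\partial$ the facets contained in $\partial\Omega$, $\mathcal{E}_h^o=\mathcal{E}_h\setminus\mathcal{E}_h^\partial$. $(\cdot,\cdot)_D$ and $\langle\cdot,\cdot\rangle_{D}$ are the $L^2$ inner products on $d$-dimensional, respectively $(d-1)$-dimensional, sets $D$ (componentwise for vectors and matrices). $n$ is the outward unit normal, $N=n\otimes n$, $T=I-N$. On an interior facet $e=\partial K^+\cap\partial K^-$, for a quantity $F$ depending on the element and its normal, $[\![F]\!]=F|_{K^+}+F|_{K^-}$,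 each evaluated with its own outward normal; e.g. $[\![b\cdot n]\!]=b^+\cdot n^++b^-\cdot n^-$. **Conventions.** $(\nabla u)_{ij}=\partial u_i/\partial x_j$, $(\nabla\cdot L)_i=\sum_j\partial L_{ij}/\partial x_j$, $(a\otimes b)_{ij}=a_ib_j$. For $d=3$, curl and cross product are the usual ones. For $d=2$: $\nabla\times b=\partial_1b_2-\partial_2b_1$ for vectors, $\nabla\times a=(\partial_2a,-\partial_1a)$ for scalars, and correspondingly $a\times b=a_1b_2-a_2b_1$ for two vectors, $a\times s=(a_2s,-a_1s)$ for a vector $a$ and a scalar $s$. **Data.** $\mathrm{Re},\mathrm{Rm},\kappa>0$ and $\alpha_1,\beta_1,\beta_2\in\mathbb R$ are constants; $f,g\in[L^2(\Omega)]^d$; $u_D,b_D$ are Dirichlet data on $\partial\Omega$ for velocity and magnetic field, with $\langle u_D\cdot n,1\rangle_{\partial\Omega}=0$; the prescribed fields are $\boldsymbol d\in[W^{1,\infty}(\Omega)]^d$ (magnetic field) and $w\in H(\mathrm{div},\Omega)$ (velocity) with $w|_K\in[W^{1,\infty}(K)]^d$ for all $K\in\Omega_h$ and $\nabla\cdot w=0$; $m:=w\cdot n$. **Spaces.** Fix an integer $k\ge1$; $\tilde d=3$ if $d=3$, $\tilde d=1$ if $d=2$. $\mathcal P_j(\Omega_h)$ (resp. $\mathcal P_j(\mathcal E_h)$) denotes functions that are polynomials of degree at most $j$ on each element (resp. facet), with no continuity imposed; $\mathcal C(\mathcal E_h)$ denotes the continuous functions on the mesh skeleton. Set $G_h=[\mathcal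 P_k(\Omega_h)]^{d\times d}$, $V_h=C_h=[\mathcal P_k(\Omega_h)]^d$, $H_h=[\mathcal P_k(\Omega_h)]^{\tilde d}$, $Q_h=S_h=\mathcal P_{k-1}(\Omega_h)$, $M_h=\Lambda_h=[\mathcal P_k(\mathcal E_h)\cap\mathcal C(\mathcal E_h)]^d$, $P_h=\Gamma_h=\mathcal P_k(\mathcal E_h)$. $V_h(K)$, $M_h(e)$, etc. denote the corresponding spaces on a single element $K$ or a single facet $e$ (restrictions). **Numerical fluxes** on $\partial K$ (normal components): $\hat F^1=-\hat u_h\otimes n$; $\hat F^2=-L_hn+m\,u_h+\hat p_h n+\tfrac12\kappa\,\boldsymbol d\times(n\times(b_h+\hat b_h))+\alpha_1(u_h-\hat u_h)$; $\hat F^3=u_h\cdot n$; $\hat F^4=-n\times\hat b_h$; $\hat F^5=n\times J_h+\hat r_hn-\tfrac12\kappa\,n\times((u_h+\hat u_h)\times\boldsymbol d)+(\beta_1T+\beta_2N)(b_h-\hat b_h)$; $\hat F^6=b_h\cdot n$. **Local equations**, for every $K\in\Omega_h$ and all $(G,v,q,H,c,s)\in G_h(K)\times V_h(K)\times Q_h(K)\times H_h(K)\times C_h(K)\times S_h(K)$: (L1) $\mathrm{Re}(L_h,G)_K+(u_h,\nabla\cdot G)_K+\langle\hat F^1,G\rangle_{\partial K}=0$; (L2) $(L_h,\nabla v)_K-(p_h,\nabla\cdot v)_K-(u_h\otimes w,\nabla v)_K+\kappa(b_h,\nabla\times(v\times\boldsymbol d))_K+\langle\hat F^2,v\rangle_{\partial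 K}=(g,v)_K$; (L3) $-(u_h,\nabla q)_K+\langle\hat F^3,q\rangle_{\partial K}=0$; (L4) $\frac{\mathrm{Rm}}{\kappa}(J_h,H)_K-(b_h,\nabla\times H)_K+\langle\hat F^4,H\rangle_{\partial K}=0$; (L5) $(J_h,\nabla\times c)_K-(r_h,\nabla\cdot c)_K-\kappa(u_h,\boldsymbol d\times(\nabla\times c))_K+\langle\hat F^5,c\rangle_{\partial K}=(f,c)_K$; (L6) $-(b_h,\nabla s)_K+\langle\hat F^6,s\rangle_{\partial K}=0$. **Conservation conditions**, for all $e\in\mathcal E_h^o$ and all $(\mu,\rho,\lambda,\gamma)\in M_h(e)\times P_h(e)\times\Lambda_h(e)\times\Gamma_h(e)$: (C1) $\langle[\![\hat F^2]\!],\mu\rangle_e=0$; (C2) $\langle[\![\hat F^3]\!],\rho\rangle_e=0$; (C3) $\langle[\![\hat F^5]\!],\lambda\rangle_e=0$; (C4) $\langle[\![\hat F^6]\!],\gamma\rangle_e=0$. **Boundary constraints**, for all $e\in\mathcal E_h^\partial$: (B1) $\langle\hat u_h\cdot n,\rho\rangle_e=\langle u_h\cdot n,\rho\rangle_e$ for all $\rho\in P_h(e)$; (B2) $\langle\hat b_h\cdot n,\gamma\rangle_e=\langle b_h\cdot n,\gamma\rangle_e$ for all $\gamma\in\Gamma_h(e)$. **Boundary conditions**, for all $e\in\mathcal E_h^\partial$ and all $(\mu,\lambda,\gamma)\in M_h(e)\times\Lambda_h(e)\times\Gamma_h(e)$: (D1) $\langle\hat u_h,\mu\rangle_e=\langle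 u_D,\mu\rangle_e$; (D2) $\langle\hat b_h,\lambda\rangle_e=\langle b_D,\lambda\rangle_e$; (D3) $\langle\hat r_h,\gamma\rangle_e=0$. **Mean value condition:** (Z) $(p_h,1)_\Omega=0$. *)

theory Defs
  imports "HOL-Analysis.Analysis"
begin

section \<open>Differential operators\<close>

definition pd :: "'d::finite \<Rightarrow> (real^'d \<Rightarrow> 'b::real_normed_vector) \<Rightarrow> real^'d \<Rightarrow> 'b" where
  "pd i f x = frechet_derivative f (at x) (axis i 1)"

definition grad_s :: "(real^'d \<Rightarrow> real) \<Rightarrow> real^'d \<Rightarrow> real^'d::finite" where
  "grad_s q x = (\<chi> i. pd i q x)"

definition grad_v :: "(real^'d \<Rightarrow> real^'d) \<Rightarrow> real^'d \<Rightarrow> real^'d^'d::finite" where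
  "grad_v u x = (\<chi> i j. pd j u x $ i)"

definition div_v :: "(real^'d \<Rightarrow> real^'d) \<Rightarrow> real^'d::finite \<Rightarrow> real" where
  "div_v v x = (\<Sum>i\<in>UNIV. pd i v x $ i)"

definition div_m :: "(real^'d \<Rightarrow> real^'d^'d) \<Rightarrow> real^'d \<Rightarrow> real^'d::finite" where
  "div_m L x = (\<chi> i. \<Sum>j\<in>UNIV. pd j L x $ i $ j)"

definition outer :: "real^'d \<Rightarrow> real^'d \<Rightarrow> real^'d^'d::finite" where
  "outer a b = (\<chi> i j. a $ i * b $ j)"


section \<open>Lebesgue and Sobolev spaces, weak derivatives\<close>

definition L2_space :: "(real^'d::finite) set \<Rightarrow> (real^'d \<Rightarrow> 'b::euclidean_space) set" where
  "L2_space U = {f. f \<in> borel_measurable (lebesgue_on U) \<and>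
                    integrable (lebesgue_on U) (\<lambda>x. (norm (f x))\<^sup>2)}"

definition Linf_space :: "(real^'d::finite) set \<Rightarrow> (real^'d \<Rightarrow> 'b::euclidean_space) set" where
  "Linf_space U = {f. f \<in> borel_measurable (lebesgue_on U) \<and>
                      (\<exists>B. AE x in lebesgue_on U. norm (f x) \<le> B)}"

definition locally_integrable :: "(real^'d::finite) set \<Rightarrow> (real^'d \<Rightarrow> 'b::euclidean_space) \<Rightarrow> bool" where
  "locally_integrable U f \<longleftrightarrow> (\<forall>C. compact C \<and> C \<subseteq> U \<longrightarrow> set_integrable lebesgue C f)"

primrec Ck :: "nat \<Rightarrow> (real^'d::finite \<Rightarrow> real) \<Rightarrow> bool" where
  "Ck 0 \<phi> \<longleftrightarrow> continuous_on UNIV \<phi>"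
| "Ck (Suc j) \<phi> \<longleftrightarrow> \<phi> differentiable_on UNIV \<and> (\<forall>i. Ck j (pd i \<phi>))"

definition test_functions :: "(real^'d::finite) set \<Rightarrow> (real^'d \<Rightarrow> real) set" where
  "test_functions U = {\<phi>. (\<forall>j. Ck j \<phi>) \<and>
     compact (closure {x. \<phi> x \<noteq> 0}) \<and> closure {x. \<phi> x \<noteq> 0} \<subseteq> U}"

definition is_weak_pd ::
  "(real^'d::finite) set \<Rightarrow> 'd \<Rightarrow> (real^'d \<Rightarrow> 'b::euclidean_space) \<Rightarrow> (real^'d \<Rightarrow> 'b) \<Rightarrow> bool" where
  "is_weak_pd U i f g \<longleftrightarrow> locally_integrable U f \<and> locally_integrable U g \<and>
     (\<forall>\<phi>\<in>test_functions U.
        (LINT x:U|lebesgue. pd i \<phi> x *\<^sub>R f x) = - (LINT x:U|lebesgue. \<phi> x *\<^sub>R g x))"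

text \<open>A weak partial derivative is unique up to a null set, so integrals do not depend on
  the representative chosen here.\<close>
definition weak_pd ::
  "(real^'d::finite) set \<Rightarrow> 'd \<Rightarrow> (real^'d \<Rightarrow> 'b::euclidean_space) \<Rightarrow> real^'d \<Rightarrow> 'b" where
  "weak_pd U i f = (SOME g. is_weak_pd U i f g)"

definition W1inf :: "(real^'d::finite) set \<Rightarrow> (real^'d \<Rightarrow> 'b::euclidean_space) set" where
  "W1inf U = {f. f \<in> Linf_space U \<and> (\<forall>i. \<exists>g\<in>Linf_space U. is_weak_pd U i f g)}"

definition is_weak_div :: "(real^'d::finite) set \<Rightarrow> (real^'d \<Rightarrow> real^'d) \<Rightarrow> (real^'d \<Rightarrow> real) \<Rightarrow> bool" where
  "is_weak_div U w g \<longleftrightarrow> locally_integrable U w \<and> locally_integrable U g \<and>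
     (\<forall>\<phi>\<in>test_functions U.
        (LINT x:U|lebesgue. w x \<bullet> grad_s \<phi> x) = - (LINT x:U|lebesgue. g x * \<phi> x))"

definition Hdiv :: "(real^'d::finite) set \<Rightarrow> (real^'d \<Rightarrow> real^'d) set" where
  "Hdiv U = {w. w \<in> L2_space U \<and> (\<exists>g\<in>L2_space U. is_weak_div U w g)}"

text \<open>Boundary values of a function in $W^{1,\infty}(K)$, $K$ a (closed) simplex: such a
  function agrees almost everywhere with exactly one continuous function on $K$.\<close>
definition elem_trace ::
  "(real^'d::finite) set \<Rightarrow> (real^'d \<Rightarrow> 'b::euclidean_space) \<Rightarrow> real^'d \<Rightarrow> 'b" where
  "elem_trace K f = (SOME g. continuous_on K g \<and> (AE x in lebesgue_on K. g x = f x))"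


section \<open>Domain, mesh, normals\<close>

text \<open>Every point of \<open>S\<close> has a relatively open neighbourhood in \<open>S\<close> that is bi-Lipschitz
  homeomorphic to a relatively open subset of a coordinate hyperplane.\<close>
definition lipschitz_hypersurface :: "(real^'d::finite) set \<Rightarrow> bool" where
  "lipschitz_hypersurface S \<longleftrightarrow>
     (\<forall>x\<in>S. \<exists>V W i \<phi> \<psi> C. open V \<and> x \<in> V \<and>
        openin (top_of_set {y :: real^'d. y $ i = 0}) W \<and>
        homeomorphism (S \<inter> V) W \<phi> \<psi> \<and>
        C-lipschitz_on (S \<inter> V) \<phi> \<and> C-lipschitz_on W \<psi>)"

definition admissible_domain :: "(real^'d::finite) set \<Rightarrow> bool" where
  "admissible_domain \<Omega> \<longleftrightarrow> open \<Omega> \<and> \<Omega> \<noteq> {} \<and> connected \<Omega> \<and> bounded \<Omega> \<and>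
     simply_connected \<Omega> \<and> lipschitz_hypersurface (frontier \<Omega>) \<and> connected (frontier \<Omega>)"

text \<open>The factor \<open>\<rho>\<close> ranges over radii of balls inscribed in \<open>K\<close>.\<close>
definition shape_regular :: "real \<Rightarrow> (real^'d::finite) set set \<Rightarrow> bool" where
  "shape_regular \<sigma> Th \<longleftrightarrow>
     (\<forall>K\<in>Th. \<exists>x \<rho>. 0 < \<rho> \<and> cball x \<rho> \<subseteq> K \<and> diameter K \<le> \<sigma> * \<rho>)"

text \<open>\<^const>\<open>triangulation\<close> includes finiteness and that any two simplices meet in a common
  (possibly empty) face; for simplices of full dimension this gives disjoint interiors.\<close>
definition mesh_of :: "(real^'d::finite) set \<Rightarrow> (real^'d) set set \<Rightarrow> bool" where
  "mesh_of \<Omega> Th \<longleftrightarrow> triangulation Th \<and> (\<forall>K\<in>Th. int CARD('d) simplex K) \<and> \<Union>Th = closure \<Omega>"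

definition facets :: "(real^'d::finite) set set \<Rightarrow> (real^'d) set set" where
  "facets Th = {e. \<exists>K\<in>Th. e facet_of K}"

definition bdry_facets :: "(real^'d::finite) set \<Rightarrow> (real^'d) set set \<Rightarrow> (real^'d) set set" where
  "bdry_facets \<Omega> Th = {e \<in> facets Th. e \<subseteq> frontier \<Omega>}"

definition int_facets :: "(real^'d::finite) set \<Rightarrow> (real^'d) set set \<Rightarrow> (real^'d) set set" where
  "int_facets \<Omega> Th = facets Th - bdry_facets \<Omega> Th"

definition adjacent ::
  "(real^'d::finite) set set \<Rightarrow> (real^'d) set \<Rightarrow> (real^'d) set \<Rightarrow> (real^'d) set \<Rightarrow> bool" where
  "adjacent Th e Kp Km \<longleftrightarrow>
     Kp \<in> Th \<and> Km \<in> Th \<and> Kp \<noteq> Km \<and> e facet_of Kp \<and> e facet_of Km"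

text \<open>The outward unit normal on the facet \<open>e\<close> of the simplex \<open>K\<close>. It is unique: taking
  \<open>y\<close> in \<open>e\<close> forces \<open>n\<close> to be orthogonal to \<open>e\<close>.\<close>
definition outward_normal :: "(real^'d::finite) set \<Rightarrow> (real^'d) set \<Rightarrow> real^'d" where
  "outward_normal K e = (THE n. norm n = 1 \<and> (\<forall>x\<in>e. \<forall>y\<in>K. n \<bullet> (y - x) \<le> 0))"


section \<open>Integrals over elements and facets\<close>

definition ip :: "(real^'d::finite) set \<Rightarrow> (real^'d \<Rightarrow> 'b::real_inner) \<Rightarrow> (real^'d \<Rightarrow> 'b) \<Rightarrow> real" where
  "ip K f g = (LINT x:K|lebesgue. f x \<bullet> g x)"

definition facet_normal :: "(real^'d::finite) set \<Rightarrow> real^'d" where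
  "facet_normal e = (SOME n. norm n = 1 \<and> (\<forall>x\<in>e. \<forall>y\<in>e. n \<bullet> (y - x) = 0))"

definition facet_prism :: "(real^'d::finite) set \<Rightarrow> (real^'d) set" where
  "facet_prism e = {x + t *\<^sub>R facet_normal e | x t. x \<in> e \<and> 0 \<le> t \<and> t \<le> 1}"

text \<open>The integral over a flat facet \<open>e\<close> with respect to $(d-1)$-dimensional surface measure.
  The right prism over \<open>e\<close> of height $1$ is isometric to $e\times[0,1]$, and
  \<open>closest_point e\<close> is its projection onto \<open>e\<close>; by Fubini the volume integral over the prism
  of a function that is constant along the normal equals the surface integral over \<open>e\<close>.\<close>
definition facet_integral :: "(real^'d::finite) set \<Rightarrow> (real^'d \<Rightarrow> real) \<Rightarrow> real" where
  "facet_integral e f = (LINT z:facet_prism e|lebesgue. f (closest_point e z))"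

definition facet_ip :: "(real^'d::finite) set \<Rightarrow> (real^'d \<Rightarrow> 'b::real_inner) \<Rightarrow> (real^'d \<Rightarrow> 'b) \<Rightarrow> real" where
  "facet_ip e f g = facet_integral e (\<lambda>x. f x \<bullet> g x)"

text \<open>The flux \<open>F e\<close> on \<open>\<partial>K\<close> is given facet by facet.\<close>
definition bdry_ip ::
  "(real^'d::finite) set \<Rightarrow> ((real^'d) set \<Rightarrow> real^'d \<Rightarrow> 'b::real_inner) \<Rightarrow> (real^'d \<Rightarrow> 'b) \<Rightarrow> real" where
  "bdry_ip K F g = (\<Sum>e | e facet_of K. facet_ip e (F e) g)"

definition facet_L2 :: "(real^'d::finite) set \<Rightarrow> (real^'d \<Rightarrow> 'b::euclidean_space) set" where
  "facet_L2 e = {f. (\<lambda>z. f (closest_point e z)) \<in> L2_space (facet_prism e)}"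


section \<open>Discrete spaces\<close>

definition polys :: "nat \<Rightarrow> (real^'d::finite \<Rightarrow> real) set" where
  "polys k = {p. \<exists>c :: ('d \<Rightarrow> nat) \<Rightarrow> real.
     \<forall>x. p x = (\<Sum>a | (\<Sum>i\<in>UNIV. a i) \<le> k. c a * (\<Prod>i\<in>UNIV. x $ i ^ a i))}"

text \<open>A discontinuous piecewise polynomial is a family \<open>q\<close> indexed by the elements. Since
  elements have nonempty interior, a polynomial on \<open>K\<close> is identified with the polynomial
  function \<open>q K\<close> on the whole space.\<close>
definition elem_scalar :: "nat \<Rightarrow> (real^'d::finite) set set \<Rightarrow> ((real^'d) set \<Rightarrow> real^'d \<Rightarrow> real) set" where
  "elem_scalar k Th = {q. \<forall>K\<in>Th. q K \<in> polys k}"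

definition elem_vector ::
  "nat \<Rightarrow> (real^'d::finite) set set \<Rightarrow> ((real^'d) set \<Rightarrow> real^'d \<Rightarrow> real^'c::finite) set" where
  "elem_vector k Th = {v. \<forall>K\<in>Th. \<forall>i. (\<lambda>x. v K x $ i) \<in> polys k}"

definition elem_matrix ::
  "nat \<Rightarrow> (real^'d::finite) set set \<Rightarrow> ((real^'d) set \<Rightarrow> real^'d \<Rightarrow> real^'d^'d) set" where
  "elem_matrix k Th = {G. \<forall>K\<in>Th. \<forall>i j. (\<lambda>x. G K x $ i $ j) \<in> polys k}"

definition facet_scalar :: "nat \<Rightarrow> (real^'d::finite) set set \<Rightarrow> ((real^'d) set \<Rightarrow> real^'d \<Rightarrow> real) set" where
  "facet_scalar k Th = {\<rho>. \<forall>e\<in>facets Th. \<exists>p\<in>polys k. \<forall>x\<in>e. \<rho> e x = p x}"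

definition skeleton_vector :: "nat \<Rightarrow> (real^'d::finite) set set \<Rightarrow> (real^'d \<Rightarrow> real^'d) set" where
  "skeleton_vector k Th = {\<mu>. continuous_on (\<Union>(facets Th)) \<mu> \<and>
     (\<forall>e\<in>facets Th. \<forall>i. \<exists>p\<in>polys k. \<forall>x\<in>e. \<mu> x $ i = p x)}"


section \<open>Data and unknowns\<close>

text \<open>\<open>Dom\<close> is $\Omega$, \<open>Mesh\<close> is $\Omega_h$, \<open>sigma\<close> the shape-regularity constant, \<open>deg\<close> is $k$,
  \<open>dfield\<close> the prescribed magnetic field $\boldsymbol d$ and \<open>wfield\<close> the prescribed velocity $w$.\<close>
record ('d::finite) ehdg_data =
  Dom :: "(real^'d) set"
  Mesh :: "(real^'d) set set"
  sigma :: real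
  deg :: nat
  Rey :: real
  Rmag :: real
  kappa :: real
  alpha1 :: real
  beta1 :: real
  beta2 :: real
  fsrc :: "real^'d \<Rightarrow> real^'d"
  gsrc :: "real^'d \<Rightarrow> real^'d"
  uD :: "real^'d \<Rightarrow> real^'d"
  bD :: "real^'d \<Rightarrow> real^'d"
  dfield :: "real^'d \<Rightarrow> real^'d"
  wfield :: "real^'d \<Rightarrow> real^'d"

text \<open>The second type parameter is the index type of $\mathbb{R}^{\tilde d}$.\<close>
record ('d::finite, 'c::finite) ehdg_fields =
  Lh :: "(real^'d) set \<Rightarrow> real^'d \<Rightarrow> real^'d^'d"
  uh :: "(real^'d) set \<Rightarrow> real^'d \<Rightarrow> real^'d"
  ph :: "(real^'d) set \<Rightarrow> real^'d \<Rightarrow> real"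
  Jh :: "(real^'d) set \<Rightarrow> real^'d \<Rightarrow> real^'c"
  bh :: "(real^'d) set \<Rightarrow> real^'d \<Rightarrow> real^'d"
  rh :: "(real^'d) set \<Rightarrow> real^'d \<Rightarrow> real"
  uhat :: "real^'d \<Rightarrow> real^'d"
  phat :: "(real^'d) set \<Rightarrow> real^'d \<Rightarrow> real"
  bhat :: "real^'d \<Rightarrow> real^'d"
  rhat :: "(real^'d) set \<Rightarrow> real^'d \<Rightarrow> real"

definition ehdg_setting :: "('d::finite) ehdg_data \<Rightarrow> bool" where
  "ehdg_setting D \<longleftrightarrow>
     admissible_domain (Dom D) \<and> mesh_of (Dom D) (Mesh D) \<and> shape_regular (sigma D) (Mesh D) \<and>
     1 \<le> deg D \<and> 0 < Rey D \<and> 0 < Rmag D \<and> 0 < kappa D \<and>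
     fsrc D \<in> L2_space (Dom D) \<and> gsrc D \<in> L2_space (Dom D) \<and>
     (\<forall>e\<in>bdry_facets (Dom D) (Mesh D). uD D \<in> facet_L2 e \<and> bD D \<in> facet_L2 e) \<and>
     (\<Sum>K\<in>Mesh D. \<Sum>e | e facet_of K \<and> e \<in> bdry_facets (Dom D) (Mesh D).
        facet_ip e (\<lambda>x. uD D x \<bullet> outward_normal K e) (\<lambda>_. 1)) = 0 \<and>
     dfield D \<in> W1inf (Dom D) \<and>
     wfield D \<in> Hdiv (Dom D) \<and> (\<forall>K\<in>Mesh D. wfield D \<in> W1inf (interior K)) \<and>
     is_weak_div (Dom D) (wfield D) (\<lambda>_. 0)"


section \<open>The E-HDG discretization\<close>

text \<open>The dimensions $d=2,3$ differ only in the two cross products: vector by vector, with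
  values in $\mathbb{R}^{\tilde d}$, and vector by element of $\mathbb{R}^{\tilde d}$. The curls
  are the formal products $\nabla\times\cdot=\sum_i e_i\times\partial_i$; their component
  formulas are checked at the end of this theory.\<close>
locale cross_products =
  fixes crv :: "real^'d::finite \<Rightarrow> real^'d \<Rightarrow> real^'c::finite"  (infixr \<open>\<times>\<^sub>v\<close> 80)
    and crs :: "real^'d \<Rightarrow> real^'c \<Rightarrow> real^'d"  (infixr \<open>\<times>\<^sub>s\<close> 80)
begin

definition curl_v :: "(real^'d \<Rightarrow> real^'d) \<Rightarrow> real^'d \<Rightarrow> real^'c" where
  "curl_v b x = (\<Sum>i\<in>UNIV. axis i 1 \<times>\<^sub>v pd i b x)"

definition curl_s :: "(real^'d \<Rightarrow> real^'c) \<Rightarrow> real^'d \<Rightarrow> real^'d" where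
  "curl_s a x = (\<Sum>i\<in>UNIV. axis i 1 \<times>\<^sub>s pd i a x)"

definition weak_curl_s :: "(real^'d) set \<Rightarrow> (real^'d \<Rightarrow> real^'c) \<Rightarrow> real^'d \<Rightarrow> real^'d" where
  "weak_curl_s U a x = (\<Sum>i\<in>UNIV. axis i 1 \<times>\<^sub>s weak_pd U i a x)"

definition flux1 :: "'d ehdg_data \<Rightarrow> ('d,'c) ehdg_fields \<Rightarrow> (real^'d) set \<Rightarrow> (real^'d) set \<Rightarrow> real^'d \<Rightarrow> real^'d^'d" where
  "flux1 D U K e x = - outer (uhat U x) (outward_normal K e)"

definition flux2 :: "'d ehdg_data \<Rightarrow> ('d,'c) ehdg_fields \<Rightarrow> (real^'d) set \<Rightarrow> (real^'d) set \<Rightarrow> real^'d \<Rightarrow> real^'d" where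
  "flux2 D U K e x =
     (let n = outward_normal K e; m = elem_trace K (wfield D) x \<bullet> n; dd = elem_trace K (dfield D) x
      in - (Lh U K x *v n) + m *\<^sub>R uh U K x + phat U e x *\<^sub>R n
         + (kappa D / 2) *\<^sub>R (dd \<times>\<^sub>s (n \<times>\<^sub>v (bh U K x + bhat U x)))
         + alpha1 D *\<^sub>R (uh U K x - uhat U x))"

definition flux3 :: "'d ehdg_data \<Rightarrow> ('d,'c) ehdg_fields \<Rightarrow> (real^'d) set \<Rightarrow> (real^'d) set \<Rightarrow> real^'d \<Rightarrow> real" where
  "flux3 D U K e x = uh U K x \<bullet> outward_normal K e"

definition flux4 :: "'d ehdg_data \<Rightarrow> ('d,'c) ehdg_fields \<Rightarrow> (real^'d) set \<Rightarrow> (real^'d) set \<Rightarrow> real^'d \<Rightarrow> real^'c" where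
  "flux4 D U K e x = - (outward_normal K e \<times>\<^sub>v bhat U x)"

definition flux5 :: "'d ehdg_data \<Rightarrow> ('d,'c) ehdg_fields \<Rightarrow> (real^'d) set \<Rightarrow> (real^'d) set \<Rightarrow> real^'d \<Rightarrow> real^'d" where
  "flux5 D U K e x =
     (let n = outward_normal K e; N = outer n n; T = mat 1 - N; dd = elem_trace K (dfield D) x
      in n \<times>\<^sub>s Jh U K x + rhat U e x *\<^sub>R n
         - (kappa D / 2) *\<^sub>R (n \<times>\<^sub>s ((uh U K x + uhat U x) \<times>\<^sub>v dd))
         + (beta1 D *\<^sub>R T + beta2 D *\<^sub>R N) *v (bh U K x - bhat U x))"

definition flux6 :: "'d ehdg_data \<Rightarrow> ('d,'c) ehdg_fields \<Rightarrow> (real^'d) set \<Rightarrow> (real^'d) set \<Rightarrow> real^'d \<Rightarrow> real" where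
  "flux6 D U K e x = bh U K x \<bullet> outward_normal K e"

definition in_discrete_spaces :: "'d ehdg_data \<Rightarrow> ('d,'c) ehdg_fields \<Rightarrow> bool" where
  "in_discrete_spaces D U \<longleftrightarrow>
     Lh U \<in> elem_matrix (deg D) (Mesh D) \<and>
     uh U \<in> elem_vector (deg D) (Mesh D) \<and>
     ph U \<in> elem_scalar (deg D - 1) (Mesh D) \<and>
     Jh U \<in> elem_vector (deg D) (Mesh D) \<and>
     bh U \<in> elem_vector (deg D) (Mesh D) \<and>
     rh U \<in> elem_scalar (deg D - 1) (Mesh D) \<and>
     uhat U \<in> skeleton_vector (deg D) (Mesh D) \<and>
     phat U \<in> facet_scalar (deg D) (Mesh D) \<and>
     bhat U \<in> skeleton_vector (deg D) (Mesh D) \<and>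
     rhat U \<in> facet_scalar (deg D) (Mesh D)"

text \<open>Test functions on a single element or facet are restrictions of members of the global
  spaces. Polynomials are differentiated classically; only the curl of $v\times\boldsymbol d$
  is a weak derivative.\<close>
definition local_equations :: "'d ehdg_data \<Rightarrow> ('d,'c) ehdg_fields \<Rightarrow> bool" where
  "local_equations D U \<longleftrightarrow>
     (\<forall>K\<in>Mesh D.
       \<forall>G\<in>elem_matrix (deg D) (Mesh D). \<forall>v\<in>elem_vector (deg D) (Mesh D).
       \<forall>q\<in>elem_scalar (deg D - 1) (Mesh D). \<forall>H\<in>elem_vector (deg D) (Mesh D).
       \<forall>c\<in>elem_vector (deg D) (Mesh D). \<forall>s\<in>elem_scalar (deg D - 1) (Mesh D).
        Rey D * ip K (Lh U K) (G K) + ip K (uh U K) (div_m (G K))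
          + bdry_ip K (flux1 D U K) (G K) = 0 \<and>
        ip K (Lh U K) (grad_v (v K)) - ip K (ph U K) (div_v (v K))
          - ip K (\<lambda>x. outer (uh U K x) (wfield D x)) (grad_v (v K))
          + kappa D * ip K (bh U K) (weak_curl_s (interior K) (\<lambda>x. v K x \<times>\<^sub>v dfield D x))
          + bdry_ip K (flux2 D U K) (v K) = ip K (gsrc D) (v K) \<and>
        - ip K (uh U K) (grad_s (q K)) + bdry_ip K (flux3 D U K) (q K) = 0 \<and>
        (Rmag D / kappa D) * ip K (Jh U K) (H K) - ip K (bh U K) (curl_s (H K))
          + bdry_ip K (flux4 D U K) (H K) = 0 \<and>
        ip K (Jh U K) (curl_v (c K)) - ip K (rh U K) (div_v (c K))
          - kappa D * ip K (uh U K) (\<lambda>x. dfield D x \<times>\<^sub>s curl_v (c K) x)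
          + bdry_ip K (flux5 D U K) (c K) = ip K (fsrc D) (c K) \<and>
        - ip K (bh U K) (grad_s (s K)) + bdry_ip K (flux6 D U K) (s K) = 0)"

definition conservation_conditions :: "'d ehdg_data \<Rightarrow> ('d,'c) ehdg_fields \<Rightarrow> bool" where
  "conservation_conditions D U \<longleftrightarrow>
     (\<forall>e\<in>int_facets (Dom D) (Mesh D). \<forall>Kp Km. adjacent (Mesh D) e Kp Km \<longrightarrow>
       (\<forall>\<mu>\<in>skeleton_vector (deg D) (Mesh D). \<forall>\<rho>\<in>facet_scalar (deg D) (Mesh D).
        \<forall>\<eta>\<in>skeleton_vector (deg D) (Mesh D). \<forall>\<gamma>\<in>facet_scalar (deg D) (Mesh D).
          facet_ip e (\<lambda>x. flux2 D U Kp e x + flux2 D U Km e x) \<mu> = 0 \<and>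
          facet_ip e (\<lambda>x. flux3 D U Kp e x + flux3 D U Km e x) (\<rho> e) = 0 \<and>
          facet_ip e (\<lambda>x. flux5 D U Kp e x + flux5 D U Km e x) \<eta> = 0 \<and>
          facet_ip e (\<lambda>x. flux6 D U Kp e x + flux6 D U Km e x) (\<gamma> e) = 0))"

definition boundary_constraints :: "'d ehdg_data \<Rightarrow> ('d,'c) ehdg_fields \<Rightarrow> bool" where
  "boundary_constraints D U \<longleftrightarrow>
     (\<forall>e\<in>bdry_facets (Dom D) (Mesh D). \<forall>K\<in>Mesh D. e facet_of K \<longrightarrow>
       (\<forall>\<rho>\<in>facet_scalar (deg D) (Mesh D).
          facet_ip e (\<lambda>x. uhat U x \<bullet> outward_normal K e) (\<rho> e)
            = facet_ip e (\<lambda>x. uh U K x \<bullet> outward_normal K e) (\<rho> e)) \<and>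
       (\<forall>\<gamma>\<in>facet_scalar (deg D) (Mesh D).
          facet_ip e (\<lambda>x. bhat U x \<bullet> outward_normal K e) (\<gamma> e)
            = facet_ip e (\<lambda>x. bh U K x \<bullet> outward_normal K e) (\<gamma> e)))"

definition boundary_conditions :: "'d ehdg_data \<Rightarrow> ('d,'c) ehdg_fields \<Rightarrow> bool" where
  "boundary_conditions D U \<longleftrightarrow>
     (\<forall>e\<in>bdry_facets (Dom D) (Mesh D).
       (\<forall>\<mu>\<in>skeleton_vector (deg D) (Mesh D). facet_ip e (uhat U) \<mu> = facet_ip e (uD D) \<mu>) \<and>
       (\<forall>\<eta>\<in>skeleton_vector (deg D) (Mesh D). facet_ip e (bhat U) \<eta> = facet_ip e (bD D) \<eta>) \<and>
       (\<forall>\<gamma>\<in>facet_scalar (deg D) (Mesh D). facet_ip e (rhat U e) (\<gamma> e) = 0))"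

definition mean_value_condition :: "'d ehdg_data \<Rightarrow> ('d,'c) ehdg_fields \<Rightarrow> bool" where
  "mean_value_condition D U \<longleftrightarrow> (\<Sum>K\<in>Mesh D. ip K (ph U K) (\<lambda>_. 1)) = 0"

definition ehdg_solution :: "'d ehdg_data \<Rightarrow> ('d,'c) ehdg_fields \<Rightarrow> bool" where
  "ehdg_solution D U \<longleftrightarrow> in_discrete_spaces D U \<and> local_equations D U \<and>
     conservation_conditions D U \<and> boundary_constraints D U \<and> boundary_conditions D U \<and>
     mean_value_condition D U"

end


section \<open>Cross products in two and three dimensions\<close>

text \<open>In two dimensions scalars are encoded as elements of \<^typ>\<open>real^1\<close>. In three dimensions
  both products are \<^const>\<open>cross3\<close>.\<close>
definition cross2v :: "real^2 \<Rightarrow> real^2 \<Rightarrow> real^1" where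
  "cross2v a b = vector [a $ 1 * b $ 2 - a $ 2 * b $ 1]"

definition cross2s :: "real^2 \<Rightarrow> real^1 \<Rightarrow> real^2" where
  "cross2s a s = vector [a $ 2 * s $ 1, - (a $ 1 * s $ 1)]"

lemma curl_v_2d:
  "cross_products.curl_v cross2v b x = vector [pd 1 b x $ 2 - pd 2 b x $ 1]"
  by (simp add: cross_products.curl_v_def cross2v_def sum_2 vec_eq_iff forall_1 vector_1
      axis_def)

lemma curl_s_2d:
  "cross_products.curl_s cross2s a x = vector [pd 2 a x $ 1, - (pd 1 a x $ 1)]"
  by (simp add: cross_products.curl_s_def cross2s_def sum_2 vec_eq_iff forall_2 vector_2
      axis_def)

lemma curl_3d:
  "cross_products.curl_v cross3 b x =
     vector [pd 2 b x $ 3 - pd 3 b x $ 2, pd 3 b x $ 1 - pd 1 b x $ 3, pd 1 b x $ 2 - pd 2 b x $ 1]"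
  "cross_products.curl_s cross3 b x = cross_products.curl_v cross3 b x"
  by (simp_all add: cross_products.curl_v_def cross_products.curl_s_def cross3_def sum_3
      vec_eq_iff forall_3 vector_3 axis_def)

end

theory Submission
  imports Defs
begin

text \<open>
  On an element \<open>K\<close>, the divergence theorem turns (L6) into $(\nabla\cdot b_h, s)_K = 0$ for all
  \<open>s\<close> of degree at most $k-1$, and $s = \nabla\cdot b_h$ is admissible. The jump of $b_h\cdot n$ and the
  difference $(b_h - \hat b_h)\cdot n$ are polynomials of degree at most $k$ on a facet, hence
  admissible in (C4) and (B2); tested against themselves, they vanish.

  The divergence theorem on a simplex with vertices \<open>C\<close> reduces, by linearity in the direction,
  to derivatives along the edges \<open>v = a - b\<close>. A line of direction \<open>v\<close> meets the simplex in a
  segment that starts on the facet opposite \<open>a\<close> and ends on the facet opposite \<open>b\<close>. Integrating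
  over these segments gives integrals over prisms with generator \<open>\<plusminus>v\<close> over the two facets, and a
  linear change of variables makes the prisms upright.
\<close>

section \<open>Integration over strips\<close>

lemma lborel_integral_translation:
  fixes f :: "'a::euclidean_space \<Rightarrow> real"
  assumes [measurable]: "f \<in> borel_measurable borel"
  shows "(\<integral>x. f (x + a) \<partial>lborel) = (\<integral>x. f x \<partial>lborel)"
proof -
  have "(\<integral>x. f x \<partial>lborel) = (\<integral>x. f x \<partial>distr lborel borel ((+) a))"
    by (simp add: lborel_distr_plus)
  also have "\<dots> = (\<integral>x. f (a + x) \<partial>lborel)"
    by (rule integral_distr) auto
  finally show ?thesis by (simp add: add.commute)
qed

lemma lborel_integrable_translation:
  fixes f :: "'a::euclidean_space \<Rightarrow> real"
  assumes "integrable lborel f"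
  shows "integrable lborel (\<lambda>x. f (x + a))"
proof -
  have "integrable (distr lborel borel ((+) a)) f"
    using assms by (simp add: lborel_distr_plus)
  then have "integrable lborel (\<lambda>x. f (a + x))"
    by (subst (asm) integrable_distr_eq) (use assms in auto)
  then show ?thesis by (simp add: add.commute)
qed

lemma lborel_integral_indicator_unit_interval:
  fixes b :: real
  shows "(\<integral>s. indicator {0..1} (b - s) \<partial>lborel) = (1::real)"
proof -
  have "(\<integral>s. indicator {0..1} (b - s) \<partial>lborel) = (\<integral>s. indicator {b-1..b} s \<partial>lborel :: real)"
    by (rule Bochner_Integration.integral_cong) (auto simp: indicator_def)
  then show ?thesis by simp
qed

text \<open>Fubini along a line, without choosing coordinates on the complementary hyperplane:
  integrating over a strip that \<open>v\<close> crosses in unit time replaces that choice.\<close>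
lemma integral_strip:
  fixes G :: "'a::euclidean_space \<Rightarrow> real"
  assumes G: "integrable lborel G" and av: "a \<bullet> v = 1"
  shows "(\<integral>z. G z \<partial>lborel) =
    (\<integral>z. indicator {0..1} (a \<bullet> z + c) * (\<integral>s. G (z + s *\<^sub>R v) \<partial>lborel) \<partial>lborel)"
proof -
  have [measurable]: "G \<in> borel_measurable borel"
    using G by auto
  \<comment> \<open>The substitution \<open>y = z + s *\<^sub>R v\<close> moves the strip by
    \<open>s\<close>, because \<open>a \<bullet> v = 1\<close>. \<open>?i s\<close> is the indicator
    of the moved strip; at every point its integral over \<open>s\<close> is 1.\<close>
  let ?i = "\<lambda>s z. indicator {0..1} (a \<bullet> z + c - s) :: real"
  have *: "integrable (lborel \<Otimes>\<^sub>M lborel) (\<lambda>(y, s). ?i s y * G y)"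
  proof (rule lborel_pair.Fubini_integrable)
    have eq: "(\<lambda>y. \<integral>s. norm (case (y, s) of (y, s) \<Rightarrow> ?i s y * G y) \<partial>lborel) = (\<lambda>y. norm (G y))"
      by (simp add: abs_mult lborel_integral_indicator_unit_interval)
    show "integrable lborel (\<lambda>y. \<integral>s. norm (case (y, s) of (y, s) \<Rightarrow> ?i s y * G y) \<partial>lborel)"
      unfolding eq using G by auto
    have "integrable lborel (\<lambda>s. indicator {0..1} (b - s) :: real)" for b :: real
    proof -
      have "(\<lambda>s. indicator {0..1} (b - s) :: real) = indicator {b-1..b}"
        by (auto simp: indicator_def fun_eq_iff)
      then show ?thesis by simp
    qed
    then show "AE y in lborel. integrable lborel (\<lambda>s. case (y, s) of (y, s) \<Rightarrow> ?i s y * G y)"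
      by auto
  qed measurable
  \<comment> \<open>Stated for a general \<open>F\<close>: the norm is needed for integrability in
    \<open>**\<close>, the identity for the value of the integral.\<close>
  have sh: "(\<integral>z. indicator {0..1} (a \<bullet> z + c) * F (G (z + s *\<^sub>R v)) \<partial>lborel) = (\<integral>y. ?i s y * F (G y) \<partial>lborel)"
    if [measurable]: "F \<in> borel_measurable borel" for s and F :: "real \<Rightarrow> real"
  proof -
    have "(\<integral>y. ?i s y * F (G y) \<partial>lborel) = (\<integral>y. ?i s (y + s *\<^sub>R v) * F (G (y + s *\<^sub>R v)) \<partial>lborel)"
      by (rule lborel_integral_translation[symmetric]) measurable
    then show ?thesis using av by (simp add: inner_add_right)
  qed
  have **: "integrable (lborel \<Otimes>\<^sub>M lborel) (\<lambda>(s, z). indicator {0..1} (a \<bullet> z + c) * G (z + s *\<^sub>R v))"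
  proof (rule lborel_pair.Fubini_integrable)
    have "integrable (lborel \<Otimes>\<^sub>M lborel) (\<lambda>(y, s). norm (?i s y * G y))"
      using integrable_norm[OF *] by (simp add: case_prod_unfold)
    from lborel_pair.integrable_snd[OF this]
    have "integrable lborel (\<lambda>s. \<integral>y. ?i s y * norm (G y) \<partial>lborel)"
      by (simp add: abs_mult)
    then show "integrable lborel (\<lambda>s. \<integral>z. norm (case (s, z) of (s, z) \<Rightarrow> indicator {0..1} (a \<bullet> z + c) * G (z + s *\<^sub>R v)) \<partial>lborel)"
      using sh[of norm] by (simp add: abs_mult)
    have "integrable lborel (\<lambda>z. G (z + s *\<^sub>R v) * indicator {z. 0 \<le> a \<bullet> z + c \<and> a \<bullet> z + c \<le> 1} z)" for s
      by (intro integrable_real_mult_indicator lborel_integrable_translation G) measurable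
    moreover have "G (z + s *\<^sub>R v) * indicator {z. 0 \<le> a \<bullet> z + c \<and> a \<bullet> z + c \<le> 1} z
        = indicator {0..1} (a \<bullet> z + c) * G (z + s *\<^sub>R v)" for s z
      by (auto simp: indicator_def)
    ultimately show "AE s in lborel. integrable lborel (\<lambda>z. case (s, z) of (s, z) \<Rightarrow> indicator {0..1} (a \<bullet> z + c) * G (z + s *\<^sub>R v))"
      by auto
  qed measurable
  have "(\<integral>z. indicator {0..1} (a \<bullet> z + c) * (\<integral>s. G (z + s *\<^sub>R v) \<partial>lborel) \<partial>lborel)
      = (\<integral>z. (\<integral>s. indicator {0..1} (a \<bullet> z + c) * G (z + s *\<^sub>R v) \<partial>lborel) \<partial>lborel)"
    by simp
  also have "\<dots> = (\<integral>s. (\<integral>z. indicator {0..1} (a \<bullet> z + c) * G (z + s *\<^sub>R v) \<partial>lborel) \<partial>lborel)"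
    by (rule lborel_pair.Fubini_integral) (rule **)
  also have "\<dots> = (\<integral>s. (\<integral>y. ?i s y * G y \<partial>lborel) \<partial>lborel)"
    using sh[of "\<lambda>x. x"] by simp
  also have "\<dots> = (\<integral>y. (\<integral>s. ?i s y * G y \<partial>lborel) \<partial>lborel)"
    by (rule lborel_pair.Fubini_integral) (rule *)
  also have "\<dots> = (\<integral>y. G y \<partial>lborel)"
    by (simp add: lborel_integral_indicator_unit_interval)
  finally show ?thesis ..
qed

text \<open>Orthogonal conjugation leaves the determinant unchanged. With an orthogonal matrix
  taking a basis vector to \<open>n\<close>, the conjugate is the identity with a single column
  altered, where Cramer's rule applies. The result gives the Jacobian of the shear used
  below.\<close>

lemma det_mat1_plus_outer:
  fixes u n :: "real^'n"
  assumes n: "norm n = 1"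
  shows "det (mat 1 + outer u n) = 1 + u \<bullet> n"
proof -
  obtain k :: 'n where True by blast
  obtain A where A: "orthogonal_matrix A" and Ak: "A *v axis k 1 = n"
    using orthogonal_matrix_exists_basis[OF n] by blast
  have tAA: "transpose A ** A = mat 1"
    using A by (simp add: orthogonal_matrix)
  have tAn: "transpose A *v n = axis k 1"
    using Ak tAA by (metis matrix_vector_mul_assoc matrix_vector_mul_lid)
  define x where "x = axis k 1 + transpose A *v u"
  have "transpose A ** (mat 1 + outer u n) ** A = mat 1 + outer (transpose A *v u) (transpose A *v n)"
  proof -
    have "transpose A ** outer u n ** A = outer (transpose A *v u) (transpose A *v n)"
      by (simp add: vec_eq_iff matrix_matrix_mult_def matrix_vector_mult_def outer_def transpose_def
          sum_distrib_left sum_distrib_right mult_ac) (intro allI, subst sum.swap, simp add: mult_ac)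
    moreover have "(X + Y) ** A = X ** A + Y ** A" for X Y :: "real^'n^'n"
      by (simp add: vec_eq_iff matrix_matrix_mult_def distrib_right sum.distrib)
    ultimately show ?thesis
      by (simp add: matrix_add_ldistrib tAA)
  qed
  \<comment> \<open>Column \<open>k\<close> of the identity is replaced by \<open>x\<close>, so the
    determinant is \<open>x $ k\<close>.\<close>
  also have "\<dots> = (\<chi> i j. if j = k then (mat 1 *v x) $ i else mat 1 $ i $ j)"
    unfolding tAn matrix_vector_mul_lid x_def
    by (simp only: vec_eq_iff outer_def mat_def axis_def vec_lambda_beta vector_add_component) simp
  finally have "det (transpose A ** (mat 1 + outer u n) ** A) = x $ k"
    using cramer_lemma[where A = "mat 1 :: real^'n^'n" and k = k and x = x] by (simp add: det_I)
  moreover have "det (transpose A ** (mat 1 + outer u n) ** A) = det (mat 1 + outer u n)"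
  proof -
    have "det (transpose A) * det A = 1"
      using tAA by (metis det_I det_mul)
    moreover have "det (transpose A ** M ** A) = (det (transpose A) * det A) * det M" for M
      by (simp only: det_mul mult_ac)
    ultimately show ?thesis by simp
  qed
  moreover have "(transpose A *v u) $ k = u \<bullet> n"
  proof -
    have "(transpose A *v u) $ k = (transpose A *v u) \<bullet> axis k 1"
      by (simp add: inner_axis)
    also have "\<dots> = u \<bullet> (A *v axis k 1)"
      using dot_lmul_matrix[of u A "axis k 1"] by simp
    finally show ?thesis by (simp add: Ak)
  qed
  ultimately show ?thesis
    by (simp add: x_def)
qed

section \<open>Integrals over oblique prisms\<close>

lemma set_integrable_continuous_compact:
  fixes f :: "'a::euclidean_space \<Rightarrow> 'b::euclidean_space"
  assumes "compact S" "continuous_on S f"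
  shows "set_integrable lebesgue S f"
  using borel_integrable_compact[OF assms] unfolding set_integrable_def
  by (metis integrable_completion borel_measurable_integrable)

lemma compact_oblique_prism:
  fixes e :: "'a::euclidean_space set"
  assumes "compact e"
  shows "compact {x + t *\<^sub>R w | x t. x \<in> e \<and> 0 \<le> t \<and> t \<le> 1}"
proof -
  have "{x + t *\<^sub>R w | x t. x \<in> e \<and> 0 \<le> t \<and> t \<le> 1} = (\<lambda>(x, t). x + t *\<^sub>R w) ` (e \<times> {0..1})"
    by force
  moreover have "compact ((\<lambda>(x, t). x + t *\<^sub>R w) ` (e \<times> {0..1}))"
    by (intro compact_continuous_image compact_Times assms) (auto intro!: continuous_intros simp: case_prod_unfold)
  ultimately show ?thesis by simp
qed

text \<open>The shear \<open>T\<close> fixes the plane \<open>n \<bullet> x = c\<close> pointwise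
  and sends the direction \<open>n\<close> to \<open>w\<close>, so it carries the upright prism onto
  the oblique one with constant Jacobian \<open>n \<bullet> w\<close>. Both integrands are
  \<open>h\<close> at the projection onto that plane, along \<open>w\<close> and along
  \<open>n\<close> respectively, so they correspond under \<open>T\<close>.\<close>

lemma integral_oblique_prism:
  fixes h :: "real^'n::{finite,wellorder} \<Rightarrow> real"
  assumes e: "compact e" "\<And>x. x \<in> e \<Longrightarrow> n \<bullet> x = c"
    and n: "norm n = 1" and nw: "n \<bullet> w \<noteq> 0" and h: "continuous_on UNIV h"
  shows "(LINT z:{x + t *\<^sub>R w | x t. x \<in> e \<and> 0 \<le> t \<and> t \<le> 1}|lebesgue.
            h (z - ((n \<bullet> z - c) / (n \<bullet> w)) *\<^sub>R w)) =
    \<bar>n \<bullet> w\<bar> * (LINT z:{x + t *\<^sub>R n | x t. x \<in> e \<and> 0 \<le> t \<and> t \<le> 1}|lebesgue.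
            h (z - (n \<bullet> z - c) *\<^sub>R n))"
    (is "(LINT z:?O|lebesgue. ?f z) = _ * (LINT z:?R|lebesgue. ?g z)")
proof -
  have nn: "n \<bullet> n = 1"
    using n by (simp add: dot_square_norm)
  define T where "T z = z + (n \<bullet> z - c) *\<^sub>R (w - n)" for z
  define T' where "T' y = y + (n \<bullet> y) *\<^sub>R (w - n)" for y
  have nT: "n \<bullet> T z - c = (n \<bullet> z - c) * (n \<bullet> w)" for z
    by (simp add: T_def inner_add_right inner_diff_right nn algebra_simps)
  have fT: "?f (T z) = ?g z" for z
  proof -
    have "(n \<bullet> T z - c) / (n \<bullet> w) = n \<bullet> z - c"
      using nw by (simp add: nT)
    moreover have "T z - (n \<bullet> z - c) *\<^sub>R w = z - (n \<bullet> z - c) *\<^sub>R n"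
      by (simp add: T_def algebra_simps)
    ultimately show ?thesis by simp
  qed
  have TR: "T ` ?R = ?O"
  proof -
    have "T (x + t *\<^sub>R n) = x + t *\<^sub>R w" if "x \<in> e" for x t
      using e(2)[OF that] by (simp add: T_def inner_add_right nn algebra_simps)
    then show ?thesis
      by (auto simp: image_iff) metis
  qed
  have inj: "inj_on T ?R"
  proof (rule inj_onI)
    fix x y assume "T x = T y"
    then have "n \<bullet> x - c = n \<bullet> y - c"
      using nT nw by (metis mult_right_cancel)
    with \<open>T x = T y\<close> show "x = y" by (simp add: T_def)
  qed
  have der: "(T has_derivative T') (at z within ?R)" for z
    unfolding T_def T'_def by (auto intro!: derivative_eq_intros)
  have "matrix T' = mat 1 + outer (w - n) n"
    by (simp add: matrix_def T'_def vec_eq_iff outer_def inner_axis) (simp add: mat_def axis_def)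
  then have det: "det (matrix T') = n \<bullet> w"
    using det_mat1_plus_outer[OF n, of "w - n"] by (simp add: inner_diff_left nn) (simp add: inner_commute)
  have cR: "compact ?R" and cO: "compact ?O"
    using compact_oblique_prism[OF e(1)] by auto
  have gi: "set_integrable lebesgue ?R ?g" and fi: "set_integrable lebesgue ?O ?f"
    using nw by (intro set_integrable_continuous_compact cR cO continuous_on_compose2[OF h] continuous_intros; simp)+
  \<comment> \<open>The change of variables theorem takes vector-valued integrands, hence the
    passage through \<open>real^1\<close>.\<close>
  let ?v = "\<lambda>f. (\<lambda>z. vec (f z) :: real^1)"
  have vi: "?v f absolutely_integrable_on S \<and> integral S (?v f) = vec (integral S f)" if "set_integrable lebesgue S f"
    for f :: "real^'n::_ \<Rightarrow> real" and S
    using that absolutely_integrable_on_1_iff[of S "?v f"] integral_on_1_eq[of S "?v f"] by simp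
  have "integral ?R (\<lambda>z. \<bar>det (matrix T')\<bar> *\<^sub>R ?v ?f (T z)) = integral ?O (?v ?f)"
    using has_absolute_integral_change_of_variables[of ?R T "\<lambda>_. T'" "?v ?f" "integral ?O (?v ?f)"]
      vi[OF fi] TR inj der cR by (auto simp: lmeasurable_compact fmeasurableD)
  then have "integral ?R (\<lambda>z. \<bar>n \<bullet> w\<bar> *\<^sub>R ?v ?g z) = integral ?O (?v ?f)"
    by (simp only: det fT)
  then have "\<bar>n \<bullet> w\<bar> *\<^sub>R vec (integral ?R ?g) = (vec (integral ?O ?f) :: real^1)"
    using vi[OF fi] vi[OF gi] by simp
  then have "\<bar>n \<bullet> w\<bar> * integral ?R ?g = integral ?O ?f"
    by (simp add: vec_eq_iff)
  then show ?thesis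
    using set_lebesgue_integral_eq_integral(2)[OF fi] set_lebesgue_integral_eq_integral(2)[OF gi] by simp
qed

section \<open>Barycentric coordinates of a simplex\<close>

text \<open>Bridge from integrals over \<open>lebesgue\<close>, as in the definitions, to
  \<open>lborel\<close>, where the Fubini argument of \<open>integral_strip\<close> takes
  place.\<close>

lemma set_integral_lebesgue_compact:
  fixes f :: "'a::euclidean_space \<Rightarrow> real"
  assumes "compact S" "continuous_on S f"
  shows "(LINT x:S|lebesgue. f x) = (\<integral>x. indicator S x * f x \<partial>lborel)"
  using borel_integrable_compact[OF assms] unfolding set_lebesgue_integral_def
  by (subst integral_completion) auto

text \<open>The sort \<open>wellorder\<close> is demanded by the library's change of variables formula.\<close>
locale full_simplex =
  fixes C :: "(real^'d::{finite,wellorder}) set"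
  assumes indep: "\<not> affine_dependent C" and card_C: "card C = CARD('d) + 1"
begin

lemma finite_C: "finite C"
  using card_C card.infinite by fastforce

lemma affine_hull_C: "affine hull C = UNIV"
proof -
  have "aff_dim C = int (CARD('d))"
    using aff_dim_affine_independent[OF indep] card_C by simp
  then show ?thesis
    using aff_dim_eq_full[of C] by simp
qed

text \<open>The differences of the other vertices from one vertex \<open>p\<close> are linearly
  independent, so a linear functional can be prescribed on them; \<open>g\<close> is its Riesz
  representative.\<close>

lemma barycentric_exists: "\<exists>g c. \<forall>b\<in>C. g \<bullet> b + c = (if b = a then 1 else 0 :: real)"
proof -
  obtain p where p: "p \<in> C" using card_C by fastforce
  define D where "D = (\<lambda>x. x - p) ` (C - {p})"
  have "independent D"
    using indep p affine_dependent_iff_dependent[of p "C - {p}"]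
    by (simp add: D_def insert_absorb)
  \<comment> \<open>On \<open>b - p\<close> the functional must take the difference of the desired
    values at \<open>b\<close> and \<open>p\<close>; the additive constant then corrects the value
    at \<open>p\<close>.\<close>
  from linear_independent_extend[OF this, of "\<lambda>y. (if y + p = a then 1 else 0) - (if p = a then 1 else 0 :: real)"]
  obtain h where h: "linear h" "\<And>y. y \<in> D \<Longrightarrow> h y = (if y + p = a then 1 else 0) - (if p = a then 1 else 0 :: real)"
    by blast
  define g :: "real^'d::_" where "g = (\<Sum>i\<in>Basis. h i *\<^sub>R i)"
  have g: "g \<bullet> x = h x" for x
  proof -
    have "h x = h (\<Sum>i\<in>Basis. (x \<bullet> i) *\<^sub>R i)" by (simp add: euclidean_representation)
    also have "\<dots> = g \<bullet> x"
      by (simp add: linear_sum[OF h(1)] linear_cmul[OF h(1)] g_def inner_sum_left inner_commute[of x] mult.commute)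
    finally show ?thesis by simp
  qed
  have "h b - h p + (if p = a then 1 else 0) = (if b = a then 1 else 0)" if "b \<in> C" for b
  proof (cases "b = p")
    case False
    then have "b - p \<in> D" using that by (auto simp: D_def)
    from h(2)[OF this] show ?thesis by (simp add: linear_diff[OF h(1)])
  qed simp
  then show ?thesis
    by (intro exI[of _ g] exI[of _ "- h p + (if p = a then 1 else 0)"]) (simp add: g algebra_simps)
qed

text \<open>Gradient of the barycentric coordinate of \<open>a\<close>. For \<open>a\<close> in
  \<open>C\<close> it is an inward normal to the facet opposite \<open>a\<close>, and its length is
  the reciprocal of the height of \<open>a\<close> over that facet.\<close>

definition bgrad :: "real^'d::_ \<Rightarrow> real^'d::_" where
  "bgrad a = (SOME g. \<exists>c. \<forall>b\<in>C. g \<bullet> b + c = (if b = a then 1 else 0 :: real))"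

definition boff :: "real^'d::_ \<Rightarrow> real" where
  "boff a = (SOME c. \<forall>b\<in>C. bgrad a \<bullet> b + c = (if b = a then 1 else 0 :: real))"

definition bary :: "real^'d::_ \<Rightarrow> real^'d::_ \<Rightarrow> real" where
  "bary a x = bgrad a \<bullet> x + boff a"

lemma bary_vertex:
  assumes "b \<in> C" shows "bary a b = (if b = a then 1 else 0)"
proof -
  have "\<exists>c. \<forall>b\<in>C. bgrad a \<bullet> b + c = (if b = a then 1 else 0 :: real)"
    unfolding bgrad_def by (rule someI_ex) (rule barycentric_exists)
  then have "\<forall>b\<in>C. bgrad a \<bullet> b + boff a = (if b = a then 1 else 0 :: real)"
    unfolding boff_def by (rule someI_ex)
  with assms show ?thesis by (simp add: bary_def)
qed

lemma bary_add: "bary a (x + v) = bary a x + bgrad a \<bullet> v"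
  by (simp add: bary_def inner_add_right)

lemma bary_add_scaleR: "bary a (x + t *\<^sub>R v) = bary a x + t * (bgrad a \<bullet> v)"
  by (simp add: bary_def inner_add_right)

lemma continuous_bary: "continuous_on S (bary a)"
  unfolding bary_def by (intro continuous_intros)

text \<open>An affine function takes an affine combination to the same combination of its vertex
  values, and those of \<open>bary a\<close> are 1 at \<open>a\<close> and 0 elsewhere.\<close>

lemma bary_combination:
  assumes "a \<in> C" and u: "sum u C = 1"
  shows "bary a (\<Sum>b\<in>C. u b *\<^sub>R b) = u a"
proof -
  have "bary a (\<Sum>b\<in>C. u b *\<^sub>R b) = (\<Sum>b\<in>C. u b * (bgrad a \<bullet> b)) + boff a * sum u C"
    by (simp add: bary_def inner_sum_right u)
  also have "\<dots> = (\<Sum>b\<in>C. u b * bary a b)"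
    by (simp add: bary_def sum_distrib_right distrib_left sum.distrib mult.commute)
  also have "\<dots> = (\<Sum>b\<in>C. if b = a then u b else 0)"
    by (intro sum.cong) (auto simp: bary_vertex)
  finally show ?thesis using assms finite_C by (simp add: sum.delta')
qed

text \<open>The vertices span the space affinely, and by \<open>bary_combination\<close> the
  coefficients of any affine representation of \<open>x\<close> are its barycentric
  coordinates.\<close>

lemma bary_representation:
  shows sum_bary: "(\<Sum>a\<in>C. bary a x) = 1"
    and sum_bary_scaleR: "(\<Sum>a\<in>C. bary a x *\<^sub>R a) = x"
proof -
  have "x \<in> affine hull C" using affine_hull_C by simp
  then obtain u where u: "sum u C = 1" "(\<Sum>v\<in>C. u v *\<^sub>R v) = x"
    unfolding affine_hull_finite[OF finite_C] by blast
  have "bary a x = u a" if "a \<in> C" for a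
    using bary_combination[OF that u(1)] u(2) by simp
  then show "(\<Sum>a\<in>C. bary a x) = 1" "(\<Sum>a\<in>C. bary a x *\<^sub>R a) = x"
    using u by (simp_all cong: sum.cong)
qed

text \<open>Derivative along \<open>v\<close> of the preceding representation, taken as the
  difference of its values at \<open>v\<close> and 0.\<close>

lemma sum_bgrad_scaleR: "(\<Sum>a\<in>C. (bgrad a \<bullet> v) *\<^sub>R a) = v"
proof -
  have "(\<Sum>a\<in>C. (bgrad a \<bullet> v) *\<^sub>R a) = (\<Sum>a\<in>C. bary a (0 + v) *\<^sub>R a) - (\<Sum>a\<in>C. bary a 0 *\<^sub>R a)"
    unfolding bary_add by (simp add: scaleR_add_left sum.distrib)
  then show ?thesis by (simp only: sum_bary_scaleR) simp
qed

lemma sum_bgrad: "(\<Sum>a\<in>C. bgrad a \<bullet> v) = 0"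
proof -
  have "(\<Sum>a\<in>C. bgrad a \<bullet> v) = (\<Sum>a\<in>C. bary a (0 + v)) - (\<Sum>a\<in>C. bary a 0)"
    unfolding bary_add by (simp add: sum.distrib)
  then show ?thesis by (simp only: sum_bary)
qed

lemma bgrad_edge:
  assumes "b \<in> C" "c \<in> C"
  shows "bgrad a \<bullet> (b - c) = (if b = a then 1 else 0) - (if c = a then 1 else 0)"
proof -
  have "bgrad a \<bullet> (b - c) = bary a b - bary a c"
    by (simp add: bary_def inner_diff_right)
  then show ?thesis by (simp add: bary_vertex assms)
qed

lemma ex_other_vertex: "\<exists>b\<in>C. b \<noteq> a"
proof (rule ccontr)
  assume "\<not> ?thesis"
  then have "C \<subseteq> {a}" by auto
  then have "card C \<le> 1" using card_mono[of "{a}" C] by simp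
  then show False using card_C by simp
qed

lemma bgrad_nonzero: assumes "a \<in> C" shows "bgrad a \<noteq> 0"
proof -
  obtain b where "b \<in> C" "b \<noteq> a" using ex_other_vertex by blast
  with bgrad_edge[of a b a] assms show ?thesis by auto
qed

section \<open>The simplex and its facets in barycentric coordinates; normals\<close>

lemma simplex_eq: "convex hull C = {x. \<forall>a\<in>C. 0 \<le> bary a x}"
proof (intro equalityI subsetI CollectI)
  fix x assume "x \<in> convex hull C"
  then obtain u where u: "\<forall>a\<in>C. 0 \<le> u a" "sum u C = 1" "(\<Sum>a\<in>C. u a *\<^sub>R a) = x"
    unfolding convex_hull_finite[OF finite_C] by blast
  then show "\<forall>a\<in>C. 0 \<le> bary a x" using bary_combination by metis
next
  fix x assume "x \<in> {x. \<forall>a\<in>C. 0 \<le> bary a x}"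
  then show "x \<in> convex hull C"
    unfolding convex_hull_finite[OF finite_C]
    by (intro CollectI exI[of _ "\<lambda>a. bary a x"]) (auto simp: bary_representation)
qed

lemma facet_eq:
  assumes "a \<in> C"
  shows "convex hull (C - {a}) = {x. bary a x = 0 \<and> (\<forall>b\<in>C - {a}. 0 \<le> bary b x)}"
proof (intro equalityI subsetI CollectI)
  fix x assume x: "x \<in> convex hull (C - {a})"
  then have *: "\<forall>b\<in>C. 0 \<le> bary b x"
    using hull_mono[of "C - {a}" C convex] simplex_eq by blast
  have "convex hull (C - {a}) \<subseteq> {x. bary a x = 0}"
  proof (rule hull_minimal)
    have "{x. bary a x = 0} = {x. bgrad a \<bullet> x = - boff a}"
      by (auto simp: bary_def)
    then show "convex {x. bary a x = 0}" by (simp add: convex_hyperplane)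
  qed (auto simp: bary_vertex)
  with x * show "bary a x = 0 \<and> (\<forall>b\<in>C - {a}. 0 \<le> bary b x)" by blast
next
  fix x assume x: "x \<in> {x. bary a x = 0 \<and> (\<forall>b\<in>C - {a}. 0 \<le> bary b x)}"
  \<comment> \<open>The summand of \<open>a\<close> vanishes, so the remaining coordinates form a
    convex combination.\<close>
  have *: "(\<Sum>b\<in>C - {a}. bary b x) = 1" "(\<Sum>b\<in>C - {a}. bary b x *\<^sub>R b) = x"
    using bary_representation[of x] x assms finite_C by (simp_all add: sum.remove)
  then show "x \<in> convex hull (C - {a})"
    unfolding convex_hull_finite[OF finite_Diff[OF finite_C]]
    by (intro CollectI exI[of _ "\<lambda>b. bary b x"]) (use x * in auto)
qed

lemma facet_of_iff:
  "e facet_of (convex hull C) \<longleftrightarrow> (\<exists>a\<in>C. e = convex hull (C - {a}))"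
  using facet_of_convex_hull_affine_independent_alt[OF indep] card_C
  by (auto simp: Suc_le_eq)

text \<open>Allows a sum over facets to be indexed by the opposite vertices. \<open>bary a\<close>
  is 1 at \<open>a\<close> but vanishes on the facet opposite \<open>a\<close>.\<close>

lemma facets_inj: "inj_on (\<lambda>a. convex hull (C - {a})) C"
proof (rule inj_onI)
  fix a b assume ab: "a \<in> C" "b \<in> C" "convex hull (C - {a}) = convex hull (C - {b})"
  show "a = b"
  proof (rule ccontr)
    assume "a \<noteq> b"
    then have "a \<in> convex hull (C - {b})" using ab by (simp add: hull_inc)
    then have "a \<in> convex hull (C - {a})" using ab(3) by simp
    then show False using facet_eq[OF ab(1)] bary_vertex[OF ab(1), of a] by auto
  qed
qed

text \<open>Expand \<open>v\<close> over the vertices with the weights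
  \<open>bgrad c \<bullet> v\<close>. They sum to zero, so \<open>b\<close> may be subtracted from
  every vertex, and \<open>n \<bullet> (c - b)\<close> vanishes unless \<open>c = a\<close>.\<close>

lemma normal_to_facet:
  assumes a: "a \<in> C" and n: "\<And>x y. x \<in> convex hull (C - {a}) \<Longrightarrow> y \<in> convex hull (C - {a}) \<Longrightarrow> n \<bullet> (y - x) = 0"
    and b: "b \<in> C" "b \<noteq> a"
  shows "n = (n \<bullet> (a - b)) *\<^sub>R bgrad a"
proof -
  have "n \<bullet> v = ((n \<bullet> (a - b)) *\<^sub>R bgrad a) \<bullet> v" for v
  proof -
    have "n \<bullet> v = (\<Sum>c\<in>C. (bgrad c \<bullet> v) * (n \<bullet> c)) - (\<Sum>c\<in>C. bgrad c \<bullet> v) * (n \<bullet> b)"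
      by (subst (1) sum_bgrad_scaleR[of v, symmetric]) (simp add: sum_bgrad inner_sum_right)
    also have "\<dots> = (\<Sum>c\<in>C. (bgrad c \<bullet> v) * (n \<bullet> (c - b)))"
      by (simp add: sum_distrib_right sum_subtractf inner_diff_right right_diff_distrib)
    also have "\<dots> = (\<Sum>c\<in>C. if c = a then (bgrad a \<bullet> v) * (n \<bullet> (a - b)) else 0)"
    proof (intro sum.cong refl)
      fix c assume "c \<in> C"
      have "n \<bullet> (c - b) = 0" if "c \<noteq> a"
        using n[of b c] that b \<open>c \<in> C\<close> by (simp add: hull_inc)
      then show "(bgrad c \<bullet> v) * (n \<bullet> (c - b)) = (if c = a then (bgrad a \<bullet> v) * (n \<bullet> (a - b)) else 0)" by auto
    qed
    finally show ?thesis using a finite_C by simp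
  qed
  then show ?thesis by (metis vector_eq_ldot inner_commute)
qed

text \<open>\<open>bary a\<close> vanishes on the facet and is nonnegative on the simplex, so its
  gradient points inward.\<close>

lemma outward_normal_eq:
  assumes a: "a \<in> C"
  shows "outward_normal (convex hull C) (convex hull (C - {a})) = - bgrad a /\<^sub>R norm (bgrad a)"
  unfolding outward_normal_def
proof (rule the_equality)
  have g: "bgrad a \<noteq> 0" by (rule bgrad_nonzero[OF a])
  have "(- bgrad a /\<^sub>R norm (bgrad a)) \<bullet> (y - x) \<le> 0" if "x \<in> convex hull (C - {a})" "y \<in> convex hull C" for x y
  proof -
    have "bgrad a \<bullet> (y - x) = bary a y - bary a x"
      by (simp add: bary_def inner_diff_right)
    also have "\<dots> \<ge> 0" using that a facet_eq simplex_eq by auto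
    finally show ?thesis by simp
  qed
  then show "norm (- bgrad a /\<^sub>R norm (bgrad a)) = 1 \<and>
     (\<forall>x\<in>convex hull (C - {a}). \<forall>y\<in>convex hull C. (- bgrad a /\<^sub>R norm (bgrad a)) \<bullet> (y - x) \<le> 0)"
    using g by auto
next
  fix n assume n: "norm n = 1 \<and> (\<forall>x\<in>convex hull (C - {a}). \<forall>y\<in>convex hull C. n \<bullet> (y - x) \<le> 0)"
  have g: "bgrad a \<noteq> 0" by (rule bgrad_nonzero[OF a])
  obtain b where b: "b \<in> C" "b \<noteq> a" using ex_other_vertex by blast
  have sub: "convex hull (C - {a}) \<subseteq> convex hull C" by (rule hull_mono) auto
  \<comment> \<open>Both points lie on the facet, so exchanging them turns the inequality into an
    equality and \<open>normal_to_facet\<close> applies.\<close>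
  have "n \<bullet> (y - x) = 0" if "x \<in> convex hull (C - {a})" "y \<in> convex hull (C - {a})" for x y
    using n that sub by (smt (verit) inner_diff_right subsetD)
  from normal_to_facet[OF a this b] have 1: "n = (n \<bullet> (a - b)) *\<^sub>R bgrad a" .
  \<comment> \<open>Testing against the vertex \<open>a\<close> fixes the sign; the unit length
    fixes the factor.\<close>
  have "n \<bullet> (a - b) \<le> 0" using n a b by (simp add: hull_inc)
  moreover have "\<bar>n \<bullet> (a - b)\<bar> * norm (bgrad a) = 1" using n 1 by (metis norm_scaleR)
  ultimately have "n \<bullet> (a - b) = - inverse (norm (bgrad a))" using g by (simp add: field_simps)
  with 1 show "n = - bgrad a /\<^sub>R norm (bgrad a)" by (metis scaleR_minus_left scaleR_minus_right)
qed

text \<open>The choice in \<open>facet_normal\<close> leaves the sign open, so only the absolute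
  value of \<open>\<mu>\<close> is determined.\<close>

lemma facet_normal_eq:
  assumes a: "a \<in> C"
  obtains \<mu> where "facet_normal (convex hull (C - {a})) = \<mu> *\<^sub>R bgrad a" "\<bar>\<mu>\<bar> * norm (bgrad a) = 1"
    "norm (facet_normal (convex hull (C - {a}))) = 1"
proof -
  let ?e = "convex hull (C - {a})"
  have g: "bgrad a \<noteq> 0" by (rule bgrad_nonzero[OF a])
  have "norm (bgrad a /\<^sub>R norm (bgrad a)) = 1 \<and> (\<forall>x\<in>?e. \<forall>y\<in>?e. (bgrad a /\<^sub>R norm (bgrad a)) \<bullet> (y - x) = 0)"
    using g a by (auto simp: facet_eq bary_def inner_diff_right)
  then have n: "norm (facet_normal ?e) = 1 \<and> (\<forall>x\<in>?e. \<forall>y\<in>?e. facet_normal ?e \<bullet> (y - x) = 0)"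
    unfolding facet_normal_def by (rule someI)
  obtain b where b: "b \<in> C" "b \<noteq> a" using ex_other_vertex by blast
  from n normal_to_facet[OF a _ b, of "facet_normal ?e"]
  have 1: "facet_normal ?e = (facet_normal ?e \<bullet> (a - b)) *\<^sub>R bgrad a" by blast
  moreover have "\<bar>facet_normal ?e \<bullet> (a - b)\<bar> * norm (bgrad a) = 1" using n 1 by (metis norm_scaleR)
  ultimately show ?thesis using that n by blast
qed

section \<open>Surface integrals as integrals over oblique prisms\<close>

lemma compact_simplex_C: "compact (convex hull C)"
  by (rule finite_imp_compact_convex_hull[OF finite_C])

lemma compact_facet: "compact (convex hull (C - {a}))"
  by (rule finite_imp_compact_convex_hull[OF finite_Diff[OF finite_C]])

text \<open>The displacement is orthogonal to the facet, so Pythagoras gives minimality; convexity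
  and closedness make the closest point unique.\<close>

lemma closest_point_facet_prism:
  assumes a: "a \<in> C" and x: "x \<in> convex hull (C - {a})"
  shows "closest_point (convex hull (C - {a})) (x + t *\<^sub>R facet_normal (convex hull (C - {a}))) = x"
proof (rule closest_point_unique[symmetric])
  let ?e = "convex hull (C - {a})" and ?n = "facet_normal (convex hull (C - {a}))"
  obtain \<mu> where \<mu>: "?n = \<mu> *\<^sub>R bgrad a" using facet_normal_eq[OF a] by metis
  show "\<forall>z\<in>?e. dist (x + t *\<^sub>R ?n) x \<le> dist (x + t *\<^sub>R ?n) z"
  proof
    fix z assume z: "z \<in> ?e"
    have "bgrad a \<bullet> (x - z) = bary a x - bary a z" by (simp add: bary_def inner_diff_right)
    then have o: "?n \<bullet> (x - z) = 0" using x z facet_eq[OF a] \<mu> by simp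
    have "(norm (t *\<^sub>R ?n))\<^sup>2 \<le> (norm ((x - z) + t *\<^sub>R ?n))\<^sup>2"
      using o by (subst norm_add_Pythagorean) (auto simp: orthogonal_def inner_commute)
    then have "norm (t *\<^sub>R ?n) \<le> norm ((x - z) + t *\<^sub>R ?n)"
      by (rule power2_le_imp_le) simp
    then show "dist (x + t *\<^sub>R ?n) x \<le> dist (x + t *\<^sub>R ?n) z"
      by (simp add: dist_norm algebra_simps)
  qed
qed (use x compact_facet compact_imp_closed in auto)

text \<open>As \<open>bary a\<close> vanishes on the facet and grows at unit rate along
  \<open>w\<close>, it recovers the parameter \<open>t\<close>.\<close>

lemma oblique_prism_eq:
  assumes a: "a \<in> C" and w: "bgrad a \<bullet> w = 1"
  shows "{x + t *\<^sub>R w | x t. x \<in> convex hull (C - {a}) \<and> 0 \<le> t \<and> t \<le> 1} =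
    {z. bary a z \<in> {0..1} \<and> z - bary a z *\<^sub>R w \<in> convex hull (C - {a})}" (is "?L = ?R")
proof (intro equalityI subsetI)
  fix z assume "z \<in> ?L"
  then obtain x t where z: "z = x + t *\<^sub>R w" "x \<in> convex hull (C - {a})" "0 \<le> t" "t \<le> 1" by blast
  then have "bary a z = t" using facet_eq[OF a] w by (simp add: bary_add_scaleR)
  with z show "z \<in> ?R" by simp
next
  fix z assume "z \<in> ?R"
  then show "z \<in> ?L"
    by (intro CollectI exI[of _ "z - bary a z *\<^sub>R w"] exI[of _ "bary a z"]) auto
qed

text \<open>Instance of \<open>integral_oblique_prism\<close> for the plane
  \<open>bary a z = 0\<close>. The Jacobian factor becomes \<open>1 / norm (bgrad a)\<close>, and on
  the upright prism the projection along \<open>n\<close> is \<open>closest_point\<close>.\<close>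

lemma facet_integral_oblique:
  assumes a: "a \<in> C" and w: "bgrad a \<bullet> w = 1" and f: "continuous_on UNIV f"
  shows "(LINT z:{z. bary a z \<in> {0..1} \<and> z - bary a z *\<^sub>R w \<in> convex hull (C - {a})}|lebesgue.
            f (z - bary a z *\<^sub>R w)) = facet_integral (convex hull (C - {a})) f / norm (bgrad a)"
proof -
  let ?e = "convex hull (C - {a})"
  define n where "n = facet_normal ?e"
  obtain \<mu> where \<mu>: "n = \<mu> *\<^sub>R bgrad a" "\<bar>\<mu>\<bar> * norm (bgrad a) = 1" and n1: "norm n = 1"
    using facet_normal_eq[OF a] unfolding n_def by metis
  have m0: "\<mu> \<noteq> 0" and g0: "norm (bgrad a) \<noteq> 0" using \<mu>(2) by auto
  define c where "c = - \<mu> * boff a"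
  have nc: "n \<bullet> z - c = \<mu> * bary a z" for z
    by (simp add: \<mu>(1) c_def bary_def algebra_simps)
  have nw: "n \<bullet> w = \<mu>" by (simp add: \<mu>(1) w)
  have ec: "n \<bullet> x = c" if "x \<in> ?e" for x
    using nc[of x] that facet_eq[OF a] by simp
  have "(LINT z:{x + t *\<^sub>R w | x t. x \<in> ?e \<and> 0 \<le> t \<and> t \<le> 1}|lebesgue.
            f (z - ((n \<bullet> z - c) / (n \<bullet> w)) *\<^sub>R w)) =
    \<bar>n \<bullet> w\<bar> * (LINT z:{x + t *\<^sub>R n | x t. x \<in> ?e \<and> 0 \<le> t \<and> t \<le> 1}|lebesgue.
            f (z - (n \<bullet> z - c) *\<^sub>R n))"
    by (rule integral_oblique_prism) (use compact_facet ec n1 nw m0 f in auto)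
  also have "(LINT z:{x + t *\<^sub>R n | x t. x \<in> ?e \<and> 0 \<le> t \<and> t \<le> 1}|lebesgue.
            f (z - (n \<bullet> z - c) *\<^sub>R n)) = facet_integral ?e f"
    unfolding facet_integral_def facet_prism_def n_def[symmetric]
  proof (rule set_lebesgue_integral_cong)
    show "{x + t *\<^sub>R n | x t. x \<in> ?e \<and> 0 \<le> t \<and> t \<le> 1} \<in> sets lebesgue"
      using compact_oblique_prism[OF compact_facet] by (simp add: lmeasurable_compact fmeasurableD)
    show "\<forall>z. z \<in> {x + t *\<^sub>R n | x t. x \<in> ?e \<and> 0 \<le> t \<and> t \<le> 1} \<longrightarrow>
      f (z - (n \<bullet> z - c) *\<^sub>R n) = f (closest_point ?e z)"
    proof (intro allI impI)
      fix z assume "z \<in> {x + t *\<^sub>R n | x t. x \<in> ?e \<and> 0 \<le> t \<and> t \<le> 1}"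
      then obtain x t where z: "z = x + t *\<^sub>R n" "x \<in> ?e" by blast
      have "n \<bullet> n = 1" using n1 by (simp add: dot_square_norm)
      then have "z - (n \<bullet> z - c) *\<^sub>R n = x"
        using ec[OF z(2)] by (simp add: z(1) inner_add_right)
      moreover have "closest_point ?e z = x"
        using closest_point_facet_prism[OF a z(2)] by (simp add: z(1) n_def)
      ultimately show "f (z - (n \<bullet> z - c) *\<^sub>R n) = f (closest_point ?e z)" by simp
    qed
  qed
  finally show ?thesis
    using m0 g0 \<mu>(2) by (simp add: oblique_prism_eq[OF a w] nc nw field_simps)
qed

lemma compact_oblique_facet_prism:
  assumes "a \<in> C" "bgrad a \<bullet> w = 1"
  shows "compact {z. bary a z \<in> {0..1} \<and> z - bary a z *\<^sub>R w \<in> convex hull (C - {a})}"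
  unfolding oblique_prism_eq[OF assms, symmetric] by (rule compact_oblique_prism[OF compact_facet])

text \<open>Along \<open>v = a - b\<close> the coordinate of \<open>a\<close> grows at unit rate,
  that of \<open>b\<close> falls at unit rate and the others are constant. A line through
  \<open>z\<close> that meets the simplex does so for parameters between \<open>- bary a z\<close>
  and \<open>bary b z\<close>, and the fundamental theorem of calculus leaves \<open>f\<close> at
  the two end points.\<close>

lemma integral_edge_derivative:
  assumes a: "a \<in> C" and b: "b \<in> C" and ab: "a \<noteq> b"
    and f: "\<And>x. (f has_derivative f' x) (at x)"
    and f': "continuous_on UNIV (\<lambda>x. f' x (a - b))"
  shows "(LINT x:convex hull C|lebesgue. f' x (a - b)) =
    facet_integral (convex hull (C - {b})) f / norm (bgrad b)
    - facet_integral (convex hull (C - {a})) f / norm (bgrad a)"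
proof -
  define v where "v = a - b"
  \<comment> \<open>\<open>Q z\<close> says that the line through \<open>z\<close> in direction
    \<open>v\<close> meets the simplex; it is invariant along \<open>v\<close>.\<close>
  define Q where "Q z \<longleftrightarrow> 0 \<le> bary a z + bary b z \<and> (\<forall>c\<in>C - {a, b}. 0 \<le> bary c z)" for z
  have va: "bgrad a \<bullet> v = 1" and vb: "bgrad b \<bullet> v = -1" and vb': "bgrad b \<bullet> (- v) = 1"
    and vc: "\<And>c. c \<in> C - {a, b} \<Longrightarrow> bgrad c \<bullet> v = 0"
    using a b ab by (auto simp: v_def bgrad_edge inner_minus_right)
  have cf: "continuous_on UNIV f"
    using f by (meson continuous_at_imp_continuous_on has_derivative_continuous)
  have C: "C = insert a (insert b (C - {a, b}))" and Ca: "C - {a} = insert b (C - {a, b})"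
    and Cb: "C - {b} = insert a (C - {a, b})"
    using a b ab by blast+
  have inK: "z + s *\<^sub>R v \<in> convex hull C \<longleftrightarrow> Q z \<and> s \<in> {- bary a z..bary b z}" for z s
  proof -
    have "z + s *\<^sub>R v \<in> convex hull C \<longleftrightarrow> (\<forall>c\<in>insert a (insert b (C - {a, b})). 0 \<le> bary c (z + s *\<^sub>R v))"
      unfolding C[symmetric] simplex_eq by simp
    then show ?thesis
      unfolding Q_def by (simp add: bary_add_scaleR va vb vc) linarith
  qed
  have Oa: "bary a z \<in> {0..1} \<and> z - bary a z *\<^sub>R v \<in> convex hull (C - {a}) \<longleftrightarrow> bary a z \<in> {0..1} \<and> Q z" for z
  proof -
    have "z - bary a z *\<^sub>R v \<in> convex hull (C - {a}) \<longleftrightarrow>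
      (\<forall>c\<in>insert b (C - {a, b}). 0 \<le> bary c (z + (- bary a z) *\<^sub>R v))"
      unfolding Ca[symmetric] facet_eq[OF a]
      using bary_add_scaleR[of a z "- bary a z" v] by (simp add: va)
    then show ?thesis
      unfolding Q_def by (simp add: bary_add_scaleR[of _ z "- bary a z" v, simplified] vb vc) linarith
  qed
  have Ob: "bary b z \<in> {0..1} \<and> z - bary b z *\<^sub>R (- v) \<in> convex hull (C - {b}) \<longleftrightarrow> bary b z \<in> {0..1} \<and> Q z" for z
  proof -
    have "z - bary b z *\<^sub>R (- v) \<in> convex hull (C - {b}) \<longleftrightarrow>
      (\<forall>c\<in>insert a (C - {a, b}). 0 \<le> bary c (z + bary b z *\<^sub>R v))"
      unfolding Cb[symmetric] facet_eq[OF b] by (simp add: bary_add_scaleR vb)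
    then show ?thesis
      unfolding Q_def by (simp add: bary_add_scaleR va vc)
  qed
  \<comment> \<open>By \<open>Oa\<close> and \<open>Ob\<close> these are the oblique prisms over the
    facets opposite \<open>a\<close> and \<open>b\<close>, with generators \<open>v\<close> and
    \<open>- v\<close>.\<close>
  define Pa where "Pa = {z. bary a z \<in> {0..1} \<and> Q z}"
  define Pb where "Pb = {z. bary b z \<in> {0..1} \<and> Q z}"
  have cPa: "compact Pa" and cPb: "compact Pb"
    using compact_oblique_facet_prism[OF a va] compact_oblique_facet_prism[OF b vb']
    unfolding Pa_def Pb_def Oa Ob by auto
  \<comment> \<open>When \<open>Q z\<close> holds, \<open>fa z\<close> and \<open>fb z\<close> are
    the values of \<open>f\<close> at the points where the line through \<open>z\<close> enters and
    leaves the simplex.\<close>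
  define fa where "fa z = f (z - bary a z *\<^sub>R v)" for z
  define fb where "fb z = f (z + bary b z *\<^sub>R v)" for z
  have cfa: "continuous_on S fa" and cfb: "continuous_on S fb" for S
    unfolding fa_def fb_def
    by (auto intro!: continuous_on_compose2[OF cf] continuous_intros continuous_bary)
  let ?K = "convex hull C"
  have ia: "integrable lborel (\<lambda>z. indicator Pa z * fa z)" and ib: "integrable lborel (\<lambda>z. indicator Pa z * fb z)"
    and ic: "integrable lborel (\<lambda>z. indicator Pb z * fb z)"
    using borel_integrable_compact[OF cPa cfa] borel_integrable_compact[OF cPa cfb] borel_integrable_compact[OF cPb cfb]
    by simp_all
  have iK: "integrable lborel (\<lambda>z. indicator ?K z * f' z v)"
    using borel_integrable_compact[OF compact_simplex_C continuous_on_subset[OF f']] by (simp add: v_def)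
  have line: "(\<integral>s. indicator ?K (z + s *\<^sub>R v) * f' (z + s *\<^sub>R v) v \<partial>lborel) = indicator {z. Q z} z * (fb z - fa z)" for z
  proof (cases "Q z")
    case True
    have "(\<integral>s. indicator ?K (z + s *\<^sub>R v) * f' (z + s *\<^sub>R v) v \<partial>lborel) =
      (\<integral>s. indicator {- bary a z..bary b z} s *\<^sub>R f' (z + s *\<^sub>R v) v \<partial>lborel)"
      using True by (intro Bochner_Integration.integral_cong) (auto simp: inK indicator_def)
    also have "\<dots> = f (z + bary b z *\<^sub>R v) - f (z + (- bary a z) *\<^sub>R v)"
    proof (rule integral_FTC_atLeastAtMost)
      show "- bary a z \<le> bary b z" using True by (simp add: Q_def)
      have line: "((\<lambda>s. z + s *\<^sub>R v) has_vector_derivative v) (at s within S)" for s S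
        by (auto intro!: derivative_eq_intros)
      show "((\<lambda>s. f (z + s *\<^sub>R v)) has_vector_derivative f' (z + s *\<^sub>R v) v) (at s within S)" for s S
        by (rule vector_derivative_diff_chain_within[OF line has_derivative_at_withinI[OF f], unfolded o_def])
      show "continuous_on {- bary a z..bary b z} (\<lambda>s. f' (z + s *\<^sub>R v) v)"
        using f' by (auto intro!: continuous_on_compose2[OF f'] continuous_intros simp: v_def)
    qed
    finally show ?thesis using True by (simp add: fa_def fb_def)
  qed (simp add: inK)
  have "(LINT x:?K|lebesgue. f' x v) = (\<integral>z. indicator ?K z * f' z v \<partial>lborel)"
    using set_integral_lebesgue_compact[OF compact_simplex_C continuous_on_subset[OF f']] by (simp add: v_def)
  \<comment> \<open>The strip is \<open>0 \<le> bary a z \<le> 1\<close>, which cuts the tube of all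
    \<open>z\<close> with \<open>Q z\<close> down to \<open>Pa\<close>.\<close>
  also have "\<dots> = (\<integral>z. indicator {0..1} (bgrad a \<bullet> z + boff a) * (\<integral>s. indicator ?K (z + s *\<^sub>R v) * f' (z + s *\<^sub>R v) v \<partial>lborel) \<partial>lborel)"
    by (rule integral_strip[OF iK va])
  also have "\<dots> = (\<integral>z. indicator Pa z * fb z - indicator Pa z * fa z \<partial>lborel)"
    unfolding line bary_def[symmetric]
    by (intro Bochner_Integration.integral_cong) (auto simp: Pa_def indicator_def)
  also have "\<dots> = (\<integral>z. indicator Pa z * fb z \<partial>lborel) - (\<integral>z. indicator Pa z * fa z \<partial>lborel)"
    by (rule Bochner_Integration.integral_diff[OF ib ia])
  \<comment> \<open>\<open>Pa\<close> and \<open>Pb\<close> are both slices of this tube that every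
    line crosses in unit time, and \<open>fb\<close> is constant along \<open>v\<close>, so its
    integrals over them agree. Integrating over \<open>Pb\<close> line by line makes this
    precise.\<close>
  also have "(\<integral>z. indicator Pa z * fb z \<partial>lborel) = (\<integral>z. indicator Pb z * fb z \<partial>lborel)"
  proof -
    have Qv: "Q (z + s *\<^sub>R v) \<longleftrightarrow> Q z" for z s
      unfolding Q_def by (simp add: bary_add_scaleR va vb vc)
    have fbv: "fb (z + s *\<^sub>R v) = fb z" for z s
      by (simp add: fb_def bary_add_scaleR vb algebra_simps)
    have "(\<integral>s. indicator Pb (z + s *\<^sub>R v) * fb (z + s *\<^sub>R v) \<partial>lborel) = indicator {z. Q z} z * fb z" for z
    proof -
      have "(\<integral>s. indicator Pb (z + s *\<^sub>R v) * fb (z + s *\<^sub>R v) \<partial>lborel) =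
        (\<integral>s. indicator {0..1} (bary b z - s) * (indicator {z. Q z} z * fb z) \<partial>lborel)"
        by (intro Bochner_Integration.integral_cong) (auto simp: Pb_def indicator_def Qv fbv bary_add_scaleR vb)
      then show ?thesis by (simp add: lborel_integral_indicator_unit_interval)
    qed
    then have "(\<integral>z. indicator Pb z * fb z \<partial>lborel) =
      (\<integral>z. indicator {0..1} (bgrad a \<bullet> z + boff a) * (indicator {z. Q z} z * fb z) \<partial>lborel)"
      using integral_strip[OF ic va, of "boff a"] by simp
    also have "\<dots> = (\<integral>z. indicator Pa z * fb z \<partial>lborel)"
      unfolding bary_def[symmetric]
      by (intro Bochner_Integration.integral_cong) (auto simp: Pa_def indicator_def)
    finally show ?thesis ..
  qed
  also have "\<dots> = (LINT z:Pb|lebesgue. f (z - bary b z *\<^sub>R (- v)))"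
    using set_integral_lebesgue_compact[OF cPb cfb] by (simp add: fb_def)
  also have "\<dots> = facet_integral (convex hull (C - {b})) f / norm (bgrad b)"
    using facet_integral_oblique[OF b vb' cf] unfolding Ob Pb_def .
  also have "(\<integral>z. indicator Pa z * fa z \<partial>lborel) = (LINT z:Pa|lebesgue. f (z - bary a z *\<^sub>R v))"
    using set_integral_lebesgue_compact[OF cPa cfa] by (simp add: fa_def)
  also have "\<dots> = facet_integral (convex hull (C - {a})) f / norm (bgrad a)"
    using facet_integral_oblique[OF a va cf] unfolding Oa Pa_def .
  finally show ?thesis by (simp add: v_def)
qed

text \<open>The direction \<open>v\<close> is a combination of the edges \<open>a - p\<close> with
  weights \<open>bgrad a \<bullet> v\<close>. The weights sum to zero, so the common term
  \<open>I p\<close> cancels, and each facet keeps the factor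
  \<open>- (bgrad a \<bullet> v) / norm (bgrad a)\<close>, the component of its outward normal along
  \<open>v\<close>.\<close>

lemma integral_directional_derivative:
  assumes f: "\<And>x. (f has_derivative f' x) (at x)"
    and f': "\<And>w. continuous_on UNIV (\<lambda>x. f' x w)"
  shows "(LINT x:convex hull C|lebesgue. f' x v) =
    (\<Sum>a\<in>C. (outward_normal (convex hull C) (convex hull (C - {a})) \<bullet> v) *
       facet_integral (convex hull (C - {a})) f)"
proof -
  define I where "I a = facet_integral (convex hull (C - {a})) f / norm (bgrad a)" for a
  obtain p where p: "p \<in> C" using ex_other_vertex by blast
  have lin: "linear (f' x)" for x
    using f by (rule has_derivative_linear)
  have edge: "(LINT x:convex hull C|lebesgue. f' x (a - p)) = I p - I a" if a: "a \<in> C" for a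
  proof (cases "a = p")
    case True
    then show ?thesis by (simp add: linear_0[OF lin])
  next
    case False
    then show ?thesis
      using integral_edge_derivative[OF a p False f f'] by (simp add: I_def)
  qed
  have "v = (\<Sum>a\<in>C. (bgrad a \<bullet> v) *\<^sub>R a) - (\<Sum>a\<in>C. bgrad a \<bullet> v) *\<^sub>R p"
    by (simp add: sum_bgrad sum_bgrad_scaleR)
  also have "\<dots> = (\<Sum>a\<in>C. (bgrad a \<bullet> v) *\<^sub>R (a - p))"
    by (simp add: scaleR_sum_left sum_subtractf scaleR_diff_right)
  finally have v: "v = (\<Sum>a\<in>C. (bgrad a \<bullet> v) *\<^sub>R (a - p))" .
  have "f' x v = (\<Sum>a\<in>C. (bgrad a \<bullet> v) * f' x (a - p))" for x
    by (subst v) (simp add: linear_sum[OF lin] linear_cmul[OF lin])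
  then have "(LINT x:convex hull C|lebesgue. f' x v) =
      (LINT x:convex hull C|lebesgue. \<Sum>a\<in>C. (bgrad a \<bullet> v) * f' x (a - p))"
    by simp
  also have "\<dots> = (\<Sum>a\<in>C. LINT x:convex hull C|lebesgue. (bgrad a \<bullet> v) * f' x (a - p))"
    unfolding set_lebesgue_integral_def scaleR_sum_right
    by (intro Bochner_Integration.integral_sum, fold set_integrable_def)
      (intro set_integrable_mult_right set_integrable_continuous_compact compact_simplex_C
        continuous_on_subset[OF f'], simp)
  also have "\<dots> = (\<Sum>a\<in>C. (bgrad a \<bullet> v) * (I p - I a))"
    by (intro sum.cong refl) (simp add: edge)
  also have "\<dots> = (\<Sum>a\<in>C. bgrad a \<bullet> v) * I p - (\<Sum>a\<in>C. (bgrad a \<bullet> v) * I a)"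
    by (simp add: right_diff_distrib sum_subtractf sum_distrib_right)
  also have "\<dots> = (\<Sum>a\<in>C. - ((bgrad a \<bullet> v) * I a))"
    by (simp add: sum_bgrad sum_negf)
  also have "\<dots> = (\<Sum>a\<in>C. (outward_normal (convex hull C) (convex hull (C - {a})) \<bullet> v) *
       facet_integral (convex hull (C - {a})) f)"
    by (intro sum.cong refl) (simp add: outward_normal_eq I_def field_simps)
  finally show ?thesis .
qed

text \<open>Prepares the use of \<open>zero_if_set_integral_zero\<close> on facets. The normal of a
  hyperplane containing the prism would be parallel to \<open>bgrad a\<close>, because the facet
  lies in it, and orthogonal to \<open>bgrad a\<close>, because the segments along \<open>n\<close>
  do.\<close>

lemma facet_prism_convex_compact_interior:
  assumes a: "a \<in> C"
  shows "convex (facet_prism (convex hull (C - {a})))"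
    and "compact (facet_prism (convex hull (C - {a})))"
    and "interior (facet_prism (convex hull (C - {a}))) \<noteq> {}"
proof -
  let ?e = "convex hull (C - {a})"
  define n where "n = facet_normal ?e"
  obtain \<mu> where \<mu>: "n = \<mu> *\<^sub>R bgrad a" and n1: "norm n = 1"
    using facet_normal_eq[OF a] unfolding n_def by metis
  have P: "facet_prism ?e = {x + t *\<^sub>R n | x t. x \<in> ?e \<and> 0 \<le> t \<and> t \<le> 1}"
    by (simp add: facet_prism_def n_def)
  \<comment> \<open>The prism is the Minkowski sum of the facet and a segment, hence convex.\<close>
  have "facet_prism ?e = (\<Union>x\<in>?e. \<Union>y\<in>(\<lambda>t. t *\<^sub>R n) ` {0..1}. {x + y})"
    unfolding P by fastforce
  moreover have "convex ((\<lambda>t. t *\<^sub>R n) ` {0..1})"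
    by (intro convex_linear_image) (auto intro: linearI simp: scaleR_add_left)
  ultimately show cv: "convex (facet_prism ?e)"
    by (simp only: convex_sums convex_convex_hull)
  show "compact (facet_prism ?e)"
    unfolding P by (rule compact_oblique_prism[OF compact_facet])
  show "interior (facet_prism ?e) \<noteq> {}"
  proof
    assume "interior (facet_prism ?e) = {}"
    from empty_interior_subset_hyperplane[OF cv this]
    obtain q c where q: "q \<noteq> 0" and sub: "facet_prism ?e \<subseteq> {x. q \<bullet> x = c}" by blast
    have qe: "q \<bullet> (x + t *\<^sub>R n) = c" if "x \<in> ?e" "0 \<le> t" "t \<le> 1" for x t
      using sub that unfolding P by blast
    obtain b where b: "b \<in> C" "b \<noteq> a" using ex_other_vertex by blast
    have "q \<bullet> (y - x) = 0" if "x \<in> ?e" "y \<in> ?e" for x y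
      using qe[OF that(1), of 0] qe[OF that(2), of 0] by (simp add: inner_diff_right)
    from normal_to_facet[OF a this b] have 1: "q = (q \<bullet> (a - b)) *\<^sub>R bgrad a" .
    have "b \<in> ?e" using b by (simp add: hull_inc)
    from qe[OF this, of 0] qe[OF this, of 1] have "q \<bullet> n = 0" by (simp add: inner_add_right)
    then have "\<mu> * (q \<bullet> bgrad a) = 0" by (simp add: \<mu>)
    moreover have "\<mu> \<noteq> 0" using n1 \<mu> by auto
    ultimately have "q \<bullet> bgrad a = 0" by simp
    then have "q \<bullet> q = 0" by (subst (2) 1) simp
    with q show False by simp
  qed
qed

lemma interior_simplex_nonempty: "interior (convex hull C) \<noteq> {}"
proof
  assume "interior (convex hull C) = {}"
  from empty_interior_subset_hyperplane[OF convex_convex_hull this]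
  obtain q c where q: "q \<noteq> 0" and sub: "convex hull C \<subseteq> {x. q \<bullet> x = c}" by blast
  then have "C \<subseteq> {x. q \<bullet> x = c}" using hull_subset[of C convex] by blast
  then have "affine hull C \<subseteq> {x. q \<bullet> x = c}"
    by (rule hull_minimal) (rule affine_hyperplane)
  then have h: "q \<bullet> x = c" for x unfolding affine_hull_C by auto
  from h[of 0] h[of q] q show False by simp
qed

end

text \<open>The integral forces \<open>h\<close> to vanish almost everywhere. In the interior the
  set where \<open>h\<close> is nonzero is open and negligible, hence empty; a closed convex set
  with interior points is the closure of its interior, so continuity covers the boundary.\<close>

lemma zero_if_set_integral_zero:
  fixes h :: "'a::euclidean_space \<Rightarrow> real"
  assumes S: "convex S" "compact S" "interior S \<noteq> {}"
    and h: "continuous_on S h" "\<And>x. x \<in> S \<Longrightarrow> 0 \<le> h x"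
    and int: "(LINT x:S|lebesgue. h x) = 0" and x: "x \<in> S"
  shows "h x = 0"
proof -
  have si: "set_integrable lebesgue S h"
    by (rule set_integrable_continuous_compact[OF S(2) h(1)])
  have "AE x in lebesgue. indicator S x *\<^sub>R h x = 0"
    using si int unfolding set_integrable_def set_lebesgue_integral_def
    by (subst (asm) integral_nonneg_eq_0_iff_AE) (auto simp: indicator_def h(2))
  then have "negligible {x. indicator S x *\<^sub>R h x \<noteq> 0}"
    by (auto simp: eventually_ae_filter negligible_iff_null_sets intro: null_sets_completion_subset)
  then have neg: "negligible {x \<in> interior S. h x \<noteq> 0}"
    by (rule negligible_subset) (use interior_subset in \<open>auto simp: indicator_def\<close>)
  have "open {x \<in> interior S. h x \<noteq> 0}"
  proof -
    have "continuous_on (interior S) h"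
      using h(1) interior_subset continuous_on_subset by blast
    then have "open (interior S \<inter> h -` (- {0}))"
      by (rule continuous_open_preimage) auto
    moreover have "interior S \<inter> h -` (- {0}) = {x \<in> interior S. h x \<noteq> 0}" by auto
    ultimately show ?thesis by simp
  qed
  with neg have "{x \<in> interior S. h x \<noteq> 0} = {}"
    using open_not_negligible by blast
  then have "\<And>y. y \<in> interior S \<Longrightarrow> h y = 0" by blast
  moreover have "closure (interior S) = S"
    using convex_closure_interior[OF S(1,3)] S(2) compact_imp_closed closure_closed by metis
  ultimately show ?thesis
    using continuous_constant_on_closure[of "interior S" h 0 x] h(1) x by simp
qed

section \<open>Polynomials and the divergence theorem\<close>

text \<open>Guards the sums in \<open>polys\<close>: over an infinite index set they would be 0 by
  default.\<close>

lemma finite_exponents: "finite {a :: 'd::finite \<Rightarrow> nat. (\<Sum>i\<in>UNIV. a i) \<le> k}"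
proof (rule finite_subset)
  show "{a :: 'd \<Rightarrow> nat. (\<Sum>i\<in>UNIV. a i) \<le> k} \<subseteq> (UNIV \<rightarrow>\<^sub>E {..k})"
  proof
    fix a :: "'d \<Rightarrow> nat" assume a: "a \<in> {a. (\<Sum>i\<in>UNIV. a i) \<le> k}"
    have "a i \<le> k" for i
      using member_le_sum[of i UNIV a] a by simp
    then show "a \<in> (UNIV \<rightarrow>\<^sub>E {..k})" by (auto simp: PiE_def)
  qed
  show "finite ((UNIV :: 'd set) \<rightarrow>\<^sub>E {..k})"
    by (intro finite_PiE) auto
qed

lemma polys_monomial:
  assumes "(\<Sum>i\<in>UNIV. a i) \<le> k"
  shows "(\<lambda>x. c * (\<Prod>i\<in>UNIV. x $ i ^ a i)) \<in> polys k"
proof -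
  have "c * (\<Prod>i\<in>UNIV. x $ i ^ a i) =
      (\<Sum>b | (\<Sum>i\<in>UNIV. b i) \<le> k. (if b = a then c else 0) * (\<Prod>i\<in>UNIV. x $ i ^ b i))" for x
    using assms by (subst sum.remove[OF finite_exponents, of a]) auto
  then show ?thesis
    unfolding polys_def by (intro CollectI exI[of _ "\<lambda>b. if b = a then c else 0"] allI)
qed

lemma polys_zero: "(\<lambda>x. 0) \<in> polys k"
  unfolding polys_def by (intro CollectI exI[of _ "\<lambda>_. 0"]) simp

lemma polys_add:
  assumes "p \<in> polys k" "q \<in> polys k" shows "(\<lambda>x. p x + q x) \<in> polys k"
proof -
  from assms obtain c c' where
    "\<And>x. p x = (\<Sum>a | (\<Sum>i\<in>UNIV. a i) \<le> k. c a * (\<Prod>i\<in>UNIV. x $ i ^ a i))"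
    "\<And>x. q x = (\<Sum>a | (\<Sum>i\<in>UNIV. a i) \<le> k. c' a * (\<Prod>i\<in>UNIV. x $ i ^ a i))"
    unfolding polys_def by auto
  then show ?thesis
    unfolding polys_def by (intro CollectI exI[of _ "\<lambda>a. c a + c' a"]) (simp add: sum.distrib distrib_right)
qed

lemma polys_cmul:
  assumes "p \<in> polys k" shows "(\<lambda>x. r * p x) \<in> polys k"
proof -
  from assms obtain c where
    "\<And>x. p x = (\<Sum>a | (\<Sum>i\<in>UNIV. a i) \<le> k. c a * (\<Prod>i\<in>UNIV. x $ i ^ a i))"
    unfolding polys_def by auto
  then show ?thesis
    unfolding polys_def by (intro CollectI exI[of _ "\<lambda>a. r * c a"]) (simp add: sum_distrib_left mult.assoc)
qed

lemma polys_diff: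
  assumes "p \<in> polys k" "q \<in> polys k" shows "(\<lambda>x. p x - q x) \<in> polys k"
  using polys_add[OF assms(1) polys_cmul[OF assms(2), of "-1"]] by simp

lemma polys_sum:
  assumes "\<And>i. i \<in> I \<Longrightarrow> p i \<in> polys k" shows "(\<lambda>x. \<Sum>i\<in>I. p i x) \<in> polys k"
  using assms by (induction I rule: infinite_finite_induct) (auto intro: polys_zero polys_add)

lemma polys_inner:
  fixes v :: "real^'d::finite \<Rightarrow> real^'c::finite"
  assumes "\<And>i. (\<lambda>x. v x $ i) \<in> polys k" shows "(\<lambda>x. v x \<bullet> n) \<in> polys k"
  using polys_sum[of UNIV "\<lambda>i x. n $ i * v x $ i" k] polys_cmul[OF assms]
  by (simp add: inner_vec_def mult.commute)

lemma continuous_on_polys: "p \<in> polys k \<Longrightarrow> continuous_on S p"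
  unfolding polys_def by (clarsimp simp: fun_eq_iff[symmetric]) (intro continuous_intros)

text \<open>By the product rule, a partial derivative of a monomial lowers one exponent by
  one.\<close>

lemma polys_has_derivative:
  assumes "p \<in> polys k"
  obtains p' where "\<And>x. (p has_derivative p' x) (at x)" "\<And>i. (\<lambda>x. p' x (axis i 1)) \<in> polys (k - 1)"
proof -
  let ?A = "{a :: 'a \<Rightarrow> nat. (\<Sum>i\<in>UNIV. a i) \<le> k}"
  from assms obtain c where c: "\<And>x. p x = (\<Sum>a\<in>?A. c a * (\<Prod>i\<in>UNIV. x $ i ^ a i))"
    unfolding polys_def by auto
  define m' where "m' a x y = (\<Sum>i\<in>UNIV. (of_nat (a i) * y $ i * x $ i ^ (a i - 1)) * (\<Prod>j\<in>UNIV - {i}. x $ j ^ a j))"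
    for a and x y :: "real^'a"
  have m': "((\<lambda>x. \<Prod>i\<in>UNIV. x $ i ^ a i) has_derivative m' a x) (at x)" for a x
    unfolding m'_def
    by (rule has_derivative_prod)
      (auto intro!: derivative_eq_intros bounded_linear_imp_has_derivative bounded_linear_vec_nth simp: mult_ac)
  have "(p has_derivative (\<lambda>y. \<Sum>a\<in>?A. c a * m' a x y)) (at x)" for x
    unfolding c[abs_def] by (intro derivative_intros m')
  moreover have "(\<lambda>x. \<Sum>a\<in>?A. c a * m' a x (axis i 1)) \<in> polys (k - 1)" for i
  proof (intro polys_sum polys_cmul)
    fix a assume a: "a \<in> ?A"
    let ?a = "a(i := a i - 1)"
    have rem: "(\<Prod>j\<in>UNIV. x $ j ^ ?a j) = x $ i ^ (a i - 1) * (\<Prod>j\<in>UNIV - {i}. x $ j ^ a j)" for x :: "real^'a"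
      by (subst prod.remove[of _ i]) (auto intro!: prod.cong)
    have eq: "m' a x (axis i 1) = of_nat (a i) * (\<Prod>j\<in>UNIV. x $ j ^ ?a j)" for x
    proof -
      have "m' a x (axis i 1) = (\<Sum>l\<in>UNIV. if l = i then of_nat (a i) * (x $ i ^ (a i - 1) * (\<Prod>j\<in>UNIV - {i}. x $ j ^ a j)) else 0)"
        unfolding m'_def by (intro sum.cong) (auto simp: axis_def)
      then show ?thesis unfolding rem by simp
    qed
    show "(\<lambda>x. m' a x (axis i 1)) \<in> polys (k - 1)"
    \<comment> \<open>Truncated subtraction leaves an exponent 0 unchanged, so in that case the
      degree does not drop; instead the factor \<open>of_nat (a i)\<close> vanishes. This also
      covers \<open>k = 0\<close>.\<close>
    proof (cases "a i = 0")
      case True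
      then show ?thesis unfolding eq by (simp add: polys_zero)
    next
      case False
      have "(\<Sum>j\<in>UNIV. a j) = a i + (\<Sum>j\<in>UNIV - {i}. a j)"
        by (rule sum.remove) auto
      moreover have "(\<Sum>j\<in>UNIV. ?a j) = (a i - 1) + (\<Sum>j\<in>UNIV - {i}. a j)"
        by (subst sum.remove[of _ i]) (auto intro!: sum.cong)
      ultimately have "(\<Sum>j\<in>UNIV. ?a j) \<le> k - 1"
        using a False by simp
      then show ?thesis unfolding eq by (rule polys_monomial)
    qed
  qed
  ultimately show ?thesis by (rule that)
qed

lemma pd_eq: "(f has_derivative f') (at x) \<Longrightarrow> pd i f x = f' (axis i 1)"
  unfolding pd_def using frechet_derivative_at by metis

lemma polys_pd:
  assumes "p \<in> polys k" shows "pd i p \<in> polys (k - 1)"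
proof -
  obtain p' where "\<And>x. (p has_derivative p' x) (at x)" "(\<lambda>x. p' x (axis i 1)) \<in> polys (k - 1)"
    using polys_has_derivative[OF assms] by metis
  moreover from this(1) have "pd i p = (\<lambda>x. p' x (axis i 1))"
    by (intro ext pd_eq)
  ultimately show ?thesis by simp
qed

text \<open>Polynomial components make \<open>v\<close> differentiable, so that
  \<open>frechet_derivative\<close> in \<open>pd\<close> is the true derivative.\<close>

lemma pd_component:
  fixes v :: "real^'d::finite \<Rightarrow> real^'c::finite"
  assumes "\<And>i. (\<lambda>x. v x $ i) \<in> polys k"
  shows "pd i v x $ j = pd i (\<lambda>x. v x $ j) x"
proof -
  have "\<exists>p'. ((\<lambda>x. v x $ j) has_derivative p') (at x)" for j
    using polys_has_derivative[OF assms] by metis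
  then obtain v' where v': "\<And>j. ((\<lambda>x. v x $ j) has_derivative v' j) (at x)" by metis
  have "(v has_derivative (\<lambda>y. \<chi> j. v' j y)) (at x)"
    by (subst has_derivative_componentwise_within)
      (auto simp: Basis_vec_def inner_axis v')
  from pd_eq[OF this] pd_eq[OF v'] show ?thesis by simp
qed

lemma div_v_eq:
  fixes v :: "real^'d::finite \<Rightarrow> real^'d"
  assumes "\<And>i. (\<lambda>x. v x $ i) \<in> polys k"
  shows "div_v v x = (\<Sum>i\<in>UNIV. pd i (\<lambda>x. v x $ i) x)"
  unfolding div_v_def by (simp add: pd_component[OF assms])

lemma polys_div_v:
  fixes v :: "real^'d::finite \<Rightarrow> real^'d"
  assumes "\<And>i. (\<lambda>x. v x $ i) \<in> polys k"
  shows "div_v v \<in> polys (k - 1)"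
  using polys_sum[OF polys_pd[OF assms]] by (simp add: div_v_eq[OF assms, abs_def])

context full_simplex
begin

section \<open>Surface integrals of continuous functions on a facet\<close>

lemma facet_nonempty: "convex hull (C - {a}) \<noteq> {}"
  using ex_other_vertex by auto

lemma closest_point_in_facet: "closest_point (convex hull (C - {a})) z \<in> convex hull (C - {a})"
  by (rule closest_point_in_set[OF compact_imp_closed[OF compact_facet] facet_nonempty])

lemma continuous_on_closest_point_facet:
  assumes "continuous_on (convex hull (C - {a})) f"
  shows "continuous_on S (\<lambda>z. f (closest_point (convex hull (C - {a})) z))"
  by (rule continuous_on_compose2[OF assms continuous_on_closest_point])
    (use compact_imp_closed[OF compact_facet] facet_nonempty closest_point_in_facet in auto)

lemma facet_set_integrable:
  assumes "a \<in> C" "continuous_on (convex hull (C - {a})) f"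
  shows "set_integrable lebesgue (facet_prism (convex hull (C - {a})))
    (\<lambda>z. f (closest_point (convex hull (C - {a})) z) :: real)"
  using assms by (intro set_integrable_continuous_compact facet_prism_convex_compact_interior
      continuous_on_closest_point_facet)

lemma facet_integral_sum:
  assumes "a \<in> C" "\<And>i. i \<in> I \<Longrightarrow> continuous_on (convex hull (C - {a})) (f i)"
  shows "facet_integral (convex hull (C - {a})) (\<lambda>x. \<Sum>i\<in>I. c i * f i x)
    = (\<Sum>i\<in>I. c i * facet_integral (convex hull (C - {a})) (f i))"
proof -
  let ?e = "convex hull (C - {a})"
  have "facet_integral ?e (\<lambda>x. \<Sum>i\<in>I. c i * f i x) =
    (\<Sum>i\<in>I. LINT z:facet_prism ?e|lebesgue. c i * f i (closest_point ?e z))"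
    unfolding facet_integral_def set_lebesgue_integral_def scaleR_sum_right
    by (intro Bochner_Integration.integral_sum, fold set_integrable_def)
      (intro set_integrable_mult_right facet_set_integrable assms)
  then show ?thesis by (simp add: facet_integral_def)
qed

lemma facet_integral_diff:
  assumes "a \<in> C" "continuous_on (convex hull (C - {a})) f" "continuous_on (convex hull (C - {a})) g"
  shows "facet_integral (convex hull (C - {a})) (\<lambda>x. f x - g x)
    = facet_integral (convex hull (C - {a})) f - facet_integral (convex hull (C - {a})) g"
  unfolding facet_integral_def
  by (rule set_integral_diff(2)[OF facet_set_integrable facet_set_integrable]) (use assms in auto)

text \<open>The facet integral is a volume integral over the prism, so the vanishing criterion
  applies to the square of \<open>g\<close> composed with the projection; points of the facet
  project to themselves.\<close>

lemma facet_zero: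
  fixes g :: "real^'d::_ \<Rightarrow> real"
  assumes a: "a \<in> C" and g: "continuous_on (convex hull (C - {a})) g"
    and 0: "facet_ip (convex hull (C - {a})) g g = 0" and x: "x \<in> convex hull (C - {a})"
  shows "g x = 0"
proof -
  let ?e = "convex hull (C - {a})"
  have xP: "x \<in> facet_prism ?e"
    unfolding facet_prism_def using x by (intro CollectI exI[of _ x] exI[of _ 0]) simp
  have "g (closest_point ?e x) * g (closest_point ?e x) = 0"
    by (rule zero_if_set_integral_zero[OF facet_prism_convex_compact_interior[OF a] _ _ _ xP])
      (use 0 in \<open>auto intro!: continuous_intros continuous_on_closest_point_facet g simp: facet_ip_def facet_integral_def\<close>)
  then show ?thesis using closest_point_self[OF x] by simp
qed

lemma bdry_ip_eq:
  "bdry_ip (convex hull C) F g = (\<Sum>a\<in>C. facet_ip (convex hull (C - {a})) (F (convex hull (C - {a}))) g)"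
proof -
  have "{e. e facet_of convex hull C} = (\<lambda>a. convex hull (C - {a})) ` C"
    using facet_of_iff by blast
  then show ?thesis
    unfolding bdry_ip_def by (simp add: sum.reindex[OF facets_inj])
qed

text \<open>Apply \<open>integral_directional_derivative\<close> to the products
  \<open>b x $ i * s x\<close>, each in the \<open>i\<close>-th coordinate direction, and sum over
  \<open>i\<close>.\<close>

lemma divergence_theorem:
  assumes b: "\<And>i. (\<lambda>x. b x $ i) \<in> polys k" and s: "s \<in> polys j"
  shows "(LINT x:convex hull C|lebesgue. div_v b x * s x) + ip (convex hull C) b (grad_s s) =
    bdry_ip (convex hull C) (\<lambda>e x. b x \<bullet> outward_normal (convex hull C) e) s"
proof -
  let ?K = "convex hull C" and ?e = "\<lambda>a. convex hull (C - {a})"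
  let ?f = "\<lambda>i x. b x $ i * s x"
  have cb: "continuous_on S (\<lambda>x. b x $ i)" and cs: "continuous_on S s" for S i
    using continuous_on_polys b s by blast+
  have cd: "continuous_on S (pd i (\<lambda>x. b x $ l))" "continuous_on S (pd i s)" for S i l
    using continuous_on_polys polys_pd b s by blast+
  have one: "(LINT x:?K|lebesgue. pd i (\<lambda>x. b x $ i) x * s x + b x $ i * pd i s x)
      = (\<Sum>a\<in>C. outward_normal ?K (?e a) $ i * facet_integral (?e a) (?f i))" for i
  proof -
    obtain b' where b': "\<And>x. ((\<lambda>x. b x $ i) has_derivative b' x) (at x)" "\<And>l. (\<lambda>x. b' x (axis l 1)) \<in> polys (k - 1)"
      using polys_has_derivative[OF b] by metis
    obtain s' where s': "\<And>x. (s has_derivative s' x) (at x)" "\<And>l. (\<lambda>x. s' x (axis l 1)) \<in> polys (j - 1)"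
      using polys_has_derivative[OF s] by metis
    \<comment> \<open>A derivative along any \<open>w\<close> is a fixed linear combination of the
      partial derivatives, which are polynomials.\<close>
    have lincont: "continuous_on UNIV (\<lambda>x. p' x w)"
      if "\<And>x. (p has_derivative p' x) (at x)" "\<And>l. (\<lambda>x. p' x (axis l 1)) \<in> polys m" for p :: "real^'d::_ \<Rightarrow> real" and p' w m
    proof -
      have "p' x w = (\<Sum>l\<in>UNIV. w $ l * p' x (axis l 1))" for x
      proof -
        have "p' x w = p' x (\<Sum>l\<in>UNIV. w $ l *\<^sub>R axis l 1)"
          by (simp add: basis_expansion[of w, symmetric, unfolded scalar_mult_eq_scaleR, symmetric])
        then show ?thesis
          using has_derivative_linear[OF that(1)] by (simp add: linear_sum linear_cmul)
      qed
      then show ?thesis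
        using continuous_on_polys[OF that(2)] by (auto intro!: continuous_intros)
    qed
    have "(LINT x:?K|lebesgue. b' x (axis i 1) * s x + b x $ i * s' x (axis i 1)) =
      (\<Sum>a\<in>C. (outward_normal ?K (?e a) \<bullet> axis i 1) * facet_integral (?e a) (?f i))"
    proof (rule integral_directional_derivative[where f' = "\<lambda>x w. b' x w * s x + b x $ i * s' x w"])
      show "(?f i has_derivative (\<lambda>w. b' x w * s x + b x $ i * s' x w)) (at x)" for x
        using has_derivative_mult[OF b'(1) s'(1), of x] by (simp add: add.commute)
      show "continuous_on UNIV (\<lambda>x. b' x w * s x + b x $ i * s' x w)" for w
        using lincont[OF b', of w] lincont[OF s', of w] by (intro continuous_intros cb cs)
    qed
    then show ?thesis by (simp add: pd_eq[OF b'(1)] pd_eq[OF s'(1)] inner_axis)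
  qed
  have int: "set_integrable lebesgue ?K h" if "continuous_on ?K h" for h :: "real^'d::_ \<Rightarrow> real"
    by (rule set_integrable_continuous_compact[OF compact_simplex_C that])
  have "(LINT x:?K|lebesgue. div_v b x * s x) + ip ?K b (grad_s s) =
    (LINT x:?K|lebesgue. div_v b x * s x + b x \<bullet> grad_s s x)"
    unfolding ip_def
    by (rule set_integral_add(2)[symmetric]; rule int)
      (auto simp: div_v_eq[OF b] grad_s_def inner_vec_def intro!: continuous_intros cb cs cd)
  also have "\<dots> = (LINT x:?K|lebesgue. \<Sum>i\<in>UNIV. pd i (\<lambda>x. b x $ i) x * s x + b x $ i * pd i s x)"
    by (simp add: div_v_eq[OF b] grad_s_def inner_vec_def sum.distrib sum_distrib_right)
  also have "\<dots> = (\<Sum>i\<in>UNIV. LINT x:?K|lebesgue. pd i (\<lambda>x. b x $ i) x * s x + b x $ i * pd i s x)"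
    unfolding set_lebesgue_integral_def scaleR_sum_right
    by (intro Bochner_Integration.integral_sum, fold set_integrable_def)
      (intro int continuous_intros cb cs cd)
  also have "\<dots> = (\<Sum>a\<in>C. \<Sum>i\<in>UNIV. outward_normal ?K (?e a) $ i * facet_integral (?e a) (?f i))"
    unfolding one by (rule sum.swap)
  also have "\<dots> = (\<Sum>a\<in>C. facet_integral (?e a) (\<lambda>x. \<Sum>i\<in>UNIV. outward_normal ?K (?e a) $ i * (b x $ i * s x)))"
    by (intro sum.cong refl facet_integral_sum[symmetric] continuous_intros cb cs)
  also have "\<dots> = bdry_ip ?K (\<lambda>e x. b x \<bullet> outward_normal ?K e) s"
    unfolding bdry_ip_eq facet_ip_def
    by (simp add: inner_vec_def sum_distrib_left sum_distrib_right mult_ac)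
  finally show ?thesis .
qed

end

section \<open>The magnetic field of a discrete solution\<close>

lemma simplex_obtain_vertices:
  fixes K :: "(real^'d::{finite,wellorder}) set"
  assumes "int CARD('d) simplex K"
  obtains C where "full_simplex C" "K = convex hull C"
  using assms unfolding simplex_def full_simplex_def by (metis of_nat_Suc of_nat_eq_iff Suc_eq_plus1 add.commute)

lemma elem_vector_zero: "(\<lambda>_ _. 0) \<in> elem_vector k Th"
  by (simp add: elem_vector_def polys_zero)

text \<open>The conditions (L6), (C4) and (B2) contain no cross product, so one argument serves both
  dimensions.\<close>

lemma ehdg_magnetic_field:
  fixes D :: "('d::{finite,wellorder}) ehdg_data" and U :: "('d, 'c::finite) ehdg_fields"
  assumes setting: "ehdg_setting D" and sol: "cross_products.ehdg_solution crv crs D U"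
  shows "(\<forall>K\<in>Mesh D. \<forall>x\<in>K. div_v (bh U K) x = 0) \<and>
    (\<forall>e\<in>int_facets (Dom D) (Mesh D). \<forall>Kp Km. adjacent (Mesh D) e Kp Km \<longrightarrow>
       (\<forall>x\<in>e. bh U Kp x \<bullet> outward_normal Kp e + bh U Km x \<bullet> outward_normal Km e = 0)) \<and>
    (\<forall>e\<in>bdry_facets (Dom D) (Mesh D). \<forall>K\<in>Mesh D. e facet_of K \<longrightarrow>
       (\<forall>x\<in>e. bh U K x \<bullet> outward_normal K e = bhat U x \<bullet> outward_normal K e))"
proof -
  let ?k = "deg D"
  have simplices: "\<And>K. K \<in> Mesh D \<Longrightarrow> int CARD('d) simplex K"
    using setting by (simp add: ehdg_setting_def mesh_of_def)
  have bh: "\<And>K i. K \<in> Mesh D \<Longrightarrow> (\<lambda>x. bh U K x $ i) \<in> polys ?k"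
    and bhat: "bhat U \<in> skeleton_vector ?k (Mesh D)"
    and local: "cross_products.local_equations crv crs D U"
    and conservation: "cross_products.conservation_conditions crv crs D U"
    and constraints: "cross_products.boundary_constraints D U"
    using sol by (simp_all add: cross_products.ehdg_solution_def cross_products.in_discrete_spaces_def elem_vector_def)
  \<comment> \<open>The local equations quantify over all six test functions at once. Zero fills the
    matrix and vector slots, and \<open>s\<close> itself the slot of \<open>q\<close>, which ranges
    over the same space.\<close>
  have L6: "- ip K (bh U K) (grad_s (s K)) + bdry_ip K (\<lambda>e x. bh U K x \<bullet> outward_normal K e) (s K) = 0"
    if K: "K \<in> Mesh D" and s: "s \<in> elem_scalar (?k - 1) (Mesh D)" for K s
  proof -
    have "(\<lambda>_ _. 0) \<in> elem_matrix ?k (Mesh D)"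
      by (simp add: elem_matrix_def polys_zero)
    moreover have "cross_products.flux6 D U K = (\<lambda>e x. bh U K x \<bullet> outward_normal K e)"
      by (intro ext) (simp add: cross_products.flux6_def)
    ultimately show ?thesis
      using local[unfolded cross_products.local_equations_def, rule_format,
          OF K _ elem_vector_zero s elem_vector_zero elem_vector_zero s] by simp
  qed
  have div_zero: "div_v (bh U K) x = 0" if K: "K \<in> Mesh D" and x: "x \<in> K" for K x
  proof -
    obtain C where C: "full_simplex C" and KC: "K = convex hull C"
      using simplex_obtain_vertices[OF simplices[OF K]] .
    have p: "div_v (bh U K) \<in> polys (?k - 1)" if "K \<in> Mesh D" for K
      by (rule polys_div_v[OF bh[OF that]])
    have "(\<lambda>K. div_v (bh U K)) \<in> elem_scalar (?k - 1) (Mesh D)"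
      using p by (simp add: elem_scalar_def)
    \<comment> \<open>The boundary terms coincide, so (L6) tested with the divergence leaves the
      integral of its square.\<close>
    from L6[OF K this] full_simplex.divergence_theorem[OF C bh[OF K] p[OF K]]
    have "(LINT x:K|lebesgue. div_v (bh U K) x * div_v (bh U K) x) = 0"
      by (simp add: KC)
    moreover have "convex K" "compact K" "interior K \<noteq> {}"
      using full_simplex.interior_simplex_nonempty[OF C] full_simplex.compact_simplex_C[OF C]
      by (simp_all add: KC)
    moreover have "continuous_on K (\<lambda>x. div_v (bh U K) x * div_v (bh U K) x)"
      by (intro continuous_intros continuous_on_polys[OF p[OF K]])
    ultimately have "div_v (bh U K) x * div_v (bh U K) x = 0"
      using zero_if_set_integral_zero[of K "\<lambda>x. div_v (bh U K) x * div_v (bh U K) x" x] x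
      by simp
    then show ?thesis by simp
  qed
  have jump_zero: "bh U Kp x \<bullet> outward_normal Kp e + bh U Km x \<bullet> outward_normal Km e = 0"
    if e: "e \<in> int_facets (Dom D) (Mesh D)" and adj: "adjacent (Mesh D) e Kp Km" and x: "x \<in> e" for e Kp Km x
  proof -
    let ?g = "\<lambda>x. bh U Kp x \<bullet> outward_normal Kp e + bh U Km x \<bullet> outward_normal Km e"
    have K: "Kp \<in> Mesh D" "Km \<in> Mesh D" and eK: "e facet_of Kp"
      using adj by (auto simp: adjacent_def)
    \<comment> \<open>The normals are constant vectors, so the jump is a polynomial on the whole
      space and can serve as test function on every facet.\<close>
    have g: "?g \<in> polys ?k"
      by (intro polys_add polys_inner bh K)
    then have g': "(\<lambda>_. ?g) \<in> facet_scalar ?k (Mesh D)"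
      by (auto simp: facet_scalar_def)
    have z: "(\<lambda>_. 0) \<in> skeleton_vector ?k (Mesh D)"
      using polys_zero by (fastforce simp: skeleton_vector_def)
    have 0: "facet_ip e ?g ?g = 0"
      using conservation[unfolded cross_products.conservation_conditions_def, rule_format,
          OF e adj z g' z g']
      by (simp add: cross_products.flux6_def)
    obtain C where C: "full_simplex C" and KC: "Kp = convex hull C"
      using simplex_obtain_vertices[OF simplices[OF K(1)]] .
    obtain a where "a \<in> C" "e = convex hull (C - {a})"
      using eK full_simplex.facet_of_iff[OF C] KC by auto
    then show ?thesis
      using full_simplex.facet_zero[OF C, of a ?g x] continuous_on_polys[OF g] 0 x by simp
  qed
  have boundary: "bh U K x \<bullet> outward_normal K e = bhat U x \<bullet> outward_normal K e"
    if e: "e \<in> bdry_facets (Dom D) (Mesh D)" and K: "K \<in> Mesh D" and eK: "e facet_of K" and x: "x \<in> e" for e K x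
  proof -
    let ?b = "\<lambda>x. bh U K x \<bullet> outward_normal K e" and ?h = "\<lambda>x. bhat U x \<bullet> outward_normal K e"
    let ?g = "\<lambda>x. ?b x - ?h x"
    have ef: "e \<in> facets (Mesh D)" using e by (simp add: bdry_facets_def)
    \<comment> \<open>\<open>bhat U\<close> is polynomial only facet by facet; \<open>q\<close>
      provides the polynomial that \<open>facet_scalar\<close> asks for on \<open>e\<close>.\<close>
    then obtain q where q: "\<And>i. q i \<in> polys ?k" "\<And>i x. x \<in> e \<Longrightarrow> bhat U x $ i = q i x"
      using bhat unfolding skeleton_vector_def by auto metis
    have qp: "(\<lambda>x. ?b x - (\<chi> i. q i x) \<bullet> outward_normal K e) \<in> polys ?k"
      by (intro polys_diff polys_inner bh K) (simp add: q)
    have gq: "?g y = ?b y - (\<chi> i. q i y) \<bullet> outward_normal K e" if "y \<in> e" for y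
      using q(2)[OF that] by (simp add: inner_vec_def)
    \<comment> \<open>Extension by zero makes the difference a global test function; at
      \<open>e\<close>, (B2) sees only its value there.\<close>
    define \<gamma> where "\<gamma> e' = (if e' = e then ?g else (\<lambda>_. 0))" for e' :: "(real^'d::_) set"
    have \<gamma>: "\<gamma> \<in> facet_scalar ?k (Mesh D)"
      using qp gq polys_zero unfolding facet_scalar_def \<gamma>_def by (auto intro!: bexI)
    have eq: "facet_ip e ?h ?g = facet_ip e ?b ?g"
      using constraints[unfolded cross_products.boundary_constraints_def, rule_format,
          OF e K eK, THEN conjunct2, rule_format, OF \<gamma>]
      by (simp add: \<gamma>_def)
    obtain C where C: "full_simplex C" and KC: "K = convex hull C"
      using simplex_obtain_vertices[OF simplices[OF K]] .
    obtain a where a: "a \<in> C" "e = convex hull (C - {a})"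
      using eK full_simplex.facet_of_iff[OF C] KC by auto
    have cb: "continuous_on e ?b"
      by (rule continuous_on_polys[OF polys_inner[OF bh[OF K]]])
    have "continuous_on e (bhat U)"
      using bhat ef continuous_on_subset unfolding skeleton_vector_def by blast
    then have ch: "continuous_on e ?h" by (intro continuous_intros)
    \<comment> \<open>Continuity of both parts allows the integral to be split; by (B2) the two
      parts are equal.\<close>
    have "facet_ip e ?g ?g = facet_ip e ?b ?g - facet_ip e ?h ?g"
      unfolding facet_ip_def inner_diff_left a(2)
      by (rule full_simplex.facet_integral_diff[OF C a(1)]; fold a(2)) (auto intro!: continuous_intros cb ch)
    with eq have "facet_ip e ?g ?g = 0" by simp
    moreover have "continuous_on e ?g" by (rule continuous_on_diff[OF cb ch])
    ultimately have "?g x = 0"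
      using full_simplex.facet_zero[OF C a(1), of ?g x] x unfolding a(2)[symmetric] by simp
    then show ?thesis by simp
  qed
  show ?thesis using div_zero jump_zero boundary by blast
qed

theorem proposition2:
  shows
    "(\<forall>(D :: 2 ehdg_data) (U :: (2,1) ehdg_fields).
        ehdg_setting D \<and> cross_products.ehdg_solution cross2v cross2s D U \<longrightarrow>
          (\<forall>K\<in>Mesh D. \<forall>x\<in>K. div_v (bh U K) x = 0) \<and>
          (\<forall>e\<in>int_facets (Dom D) (Mesh D). \<forall>Kp Km. adjacent (Mesh D) e Kp Km \<longrightarrow>
             (\<forall>x\<in>e. bh U Kp x \<bullet> outward_normal Kp e + bh U Km x \<bullet> outward_normal Km e = 0)) \<and>
          (\<forall>e\<in>bdry_facets (Dom D) (Mesh D). \<forall>K\<in>Mesh D. e facet_of K \<longrightarrow>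
             (\<forall>x\<in>e. bh U K x \<bullet> outward_normal K e = bhat U x \<bullet> outward_normal K e))) \<and>
     (\<forall>(D :: 3 ehdg_data) (U :: (3,3) ehdg_fields).
        ehdg_setting D \<and> cross_products.ehdg_solution cross3 cross3 D U \<longrightarrow>
          (\<forall>K\<in>Mesh D. \<forall>x\<in>K. div_v (bh U K) x = 0) \<and>
          (\<forall>e\<in>int_facets (Dom D) (Mesh D). \<forall>Kp Km. adjacent (Mesh D) e Kp Km \<longrightarrow>
             (\<forall>x\<in>e. bh U Kp x \<bullet> outward_normal Kp e + bh U Km x \<bullet> outward_normal Km e = 0)) \<and>
          (\<forall>e\<in>bdry_facets (Dom D) (Mesh D). \<forall>K\<in>Mesh D. e facet_of K \<longrightarrow>
             (\<forall>x\<in>e. bh U K x \<bullet> outward_normal K e = bhat U x \<bullet> outward_normal K e)))"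
  by (rule conjI; intro allI impI; elim conjE; rule ehdg_magnetic_field; assumption)

end
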